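(* Let $1<p<2$, $q>1$ and $h\in L^1_{loc}(\mathbb{R}^N)$. Then the problem $$-\Delta_p u+|u|^{q-1}u=h\quad\text{on }\mathbb{R}^N$$ has at most one weak solution $v\in W^{1,p}_{loc}(\mathbb{R}^N)\cap L^q_{loc}(\mathbb{R}^N)$. Moreover, any such weak solution $v$ satisfies $$\inf_{\mathbb{R}^N}h\le |v|^{q-1}v\le\sup_{\mathbb{R}^N}h\quad\text{a.e. on }\mathbb{R}^N .$$
   Context: $\Delta_p u=\mathrm{div}(|\nabla u|^{p-2}\nabla u)$ is the $p$-Laplacian. $C^1_0(\mathbb{R}^N)$ denotes compactly supported $C^1$ functions. A function $u\in W^{1,p}_{loc}(\mathbb{R}^N)\cap L^q_{loc}(\mathbb{R}^N)$ is a weak solution if $|\nabla u|^{p-2}\nabla u\in L^{p'}_{loc}(\mathbb{R}^N)$ ($p'=p/(p-1)$; automatic here) and $\int_{\mathbb{R}^N}|\nabla u|^{p-2}\nabla u\cdot\nabla\phi+\int_{\mathbb{R}^N}|u|^{q-1}u\,\phi=\int_{\mathbb{R}^N}h\phi$ for every $\phi\in C^1_0(\mathbb{R}^N)$. $\inf$ and $\sup$ of $h$ are essential infimum and supremum, possibly $-\infty$, $+\infty$. *)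

theory Defs
  imports "HOL-Analysis.Analysis" "HOL-Probability.Essential_Supremum"
begin

text \<open>
  Elements of Lebesgue and Sobolev spaces are represented by functions; statements about the
  corresponding classes are made almost everywhere with respect to \<^const>\<open>lebesgue\<close>.
\<close>

definition Lloc :: "real \<Rightarrow> ('a::euclidean_space \<Rightarrow> 'b::euclidean_space) set" where
  "Lloc r = {f \<in> borel_measurable lebesgue.
     \<forall>K. compact K \<longrightarrow> set_integrable lebesgue K (\<lambda>x. norm (f x) powr r)}"

definition grad :: "('a::euclidean_space \<Rightarrow> real) \<Rightarrow> 'a \<Rightarrow> 'a" where
  "grad f x = (THE D. GDERIV f x :> D)"

lemma grad_eqI:
  assumes "GDERIV f x :> D"
  shows "grad f x = D"
  unfolding grad_def
proof (rule the_equality)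
  show "GDERIV f x :> D" by (rule assms)
next
  fix D' assume "GDERIV f x :> D'"
  then have "(\<lambda>y. inner y D') = (\<lambda>y. inner y D)"
    using assms unfolding gderiv_def by (rule has_derivative_unique)
  then have "inner (D' - D) D' = inner (D' - D) D"
    by (rule fun_cong)
  then have "inner (D' - D) (D' - D) = 0"
    by (simp add: inner_diff_right)
  then show "D' = D"
    by simp
qed

definition C1_0 :: "('a::euclidean_space \<Rightarrow> real) set" where
  "C1_0 = {\<phi>. (\<forall>x. \<phi> differentiable (at x)) \<and> continuous_on UNIV (grad \<phi>) \<and>
     compact (closure (support_on UNIV \<phi>))}"

text \<open>
  First-order weak derivatives are tested against compactly supported functions of class \<open>C\<^sup>1\<close>,
  as in Gilbarg and Trudinger.
\<close>

definition weak_gradient :: "('a::euclidean_space \<Rightarrow> real) \<Rightarrow> ('a \<Rightarrow> 'a) \<Rightarrow> bool" where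
  "weak_gradient u G \<longleftrightarrow> u \<in> Lloc 1 \<and> G \<in> Lloc 1 \<and>
     (\<forall>\<phi>\<in>C1_0. (\<integral>x. u x *\<^sub>R grad \<phi> x \<partial>lebesgue) = - (\<integral>x. \<phi> x *\<^sub>R G x \<partial>lebesgue))"

definition W1loc :: "real \<Rightarrow> ('a::euclidean_space \<Rightarrow> real) set" where
  "W1loc r = {u \<in> Lloc r. \<exists>G. weak_gradient u G \<and> G \<in> Lloc r}"

text \<open>
  Since \<open>0 powr s = 0\<close>, the expression below is \<open>0\<close> where the gradient vanishes, also for
  \<open>p < 2\<close>. The weak gradient is unique almost everywhere, so the existential quantifier in the
  definition of weak solutions only names it.
\<close>

definition flux :: "real \<Rightarrow> 'a::euclidean_space \<Rightarrow> 'a" where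
  "flux p z = (norm z powr (p - 2)) *\<^sub>R z"

definition weak_solution ::
    "real \<Rightarrow> real \<Rightarrow> ('a::euclidean_space \<Rightarrow> real) \<Rightarrow> ('a \<Rightarrow> real) \<Rightarrow> bool" where
  "weak_solution p q h u \<longleftrightarrow> u \<in> W1loc p \<inter> Lloc q \<and>
     (\<exists>G. weak_gradient u G \<and> (\<lambda>x. flux p (G x)) \<in> Lloc (p / (p - 1)) \<and>
       (\<forall>\<phi>\<in>C1_0.
          (\<integral>x. inner (flux p (G x)) (grad \<phi> x) \<partial>lebesgue)
          + (\<integral>x. \<bar>u x\<bar> powr (q - 1) * u x * \<phi> x \<partial>lebesgue)
          = (\<integral>x. h x * \<phi> x \<partial>lebesgue)))"

text \<open>The dual of \<^const>\<open>esssup\<close>.\<close>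

definition essinf :: "'a measure \<Rightarrow> ('a \<Rightarrow> ereal) \<Rightarrow> ereal" where
  "essinf M f = (if f \<in> borel_measurable M then Liminf (ae_filter M) f else bot)"

end

theory Submission
  imports Defs
begin

text \<open>
  Everything follows from a comparison principle for \<open>w = u - v\<close>, where \<open>D\<close> is the difference of
  the two fluxes, \<open>G\<close> that of the gradients, and \<open>b\<close> that of the zero order terms.
  For \<open>1 < p < 2\<close> the flux satisfies \<open>|D|^p' \<le> C (D \<bullet> G)\<close>, and \<open>b \<ge> c w^q\<close> where
  \<open>w > 0\<close>. Testing with \<open>T(w) \<psi>\<close>, where \<open>T\<close> is bounded and increasing with \<open>T = 0\<close> on
  negative numbers and \<open>\<psi>\<close> is a cutoff function on the ball of radius \<open>R\<close>, a three term Young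
  inequality absorbs \<open>|D| T(w) |\<nabla>\<psi>|\<close> into the two nonnegative terms up to \<open>K R^(-M)\<close>. Here \<open>T\<close>
  vanishes to high order at \<open>0\<close> and \<open>T'\<close> decays only slightly faster than \<open>1/t\<close>, which permits
  \<open>M\<close> to exceed the dimension; letting \<open>R\<close> tend to infinity gives \<open>w \<le> 0\<close>.
  The bounds on a solution are comparisons with constants.

  No chain rule for weakly differentiable functions is needed: the test function is built from
  \<open>\<eta> * w\<close> for a \<open>C\<^sup>1\<close> mollifier \<open>\<eta>\<close>, so it is itself of class \<open>C\<^sup>1\<close>, and one passes to the limit
  in the resulting inequality.
\<close>

section \<open>Calculus inequalities and the test profile\<close>

text \<open>The solutions carry no growth condition at infinity, so the cutoff error must be
  absorbed whatever the size of \<open>w\<close>. A two term Young inequality against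
  \<open>T'(w) \<psi> |D|^p'\<close> would leave a multiple of
  \<open>T^p T'^(1-p) \<psi>^(1-p) |grad \<psi>|^p\<close>. If \<open>T'\<close> decayed like
  \<open>1/t\<close>, this would grow like \<open>w^(p-1)\<close>; the slightly faster decay that
  keeps \<open>T\<close> bounded makes the power slightly larger, and the zero order term
  \<open>w^q T(w) \<psi>\<close> still dominates it because \<open>q > p - 1\<close>. The surplus is
  turned into the third Young factor, a constant times \<open>1/R\<close>, whose weight
  \<open>1/M\<close> can be made small. Boundedness of \<open>T\<close> matters because
  \<open>b\<close> is only locally integrable.

  The restriction \<open>p < 2\<close> enters through coercivity: the flux with the conjugate
  exponent \<open>p'\<close> inverts the flux with exponent \<open>p\<close>, and
  \<open>p' > 2\<close> lies in the range where strong monotonicity holds without weights. Applied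
  to the fluxes instead of the gradients it bounds \<open>|D|^p'\<close>, which is the power that
  the Young inequality consumes.\<close>

lemma DERIV_pos_part_power:
  fixes t :: real
  assumes "2 \<le> k"
  shows "((\<lambda>t. max 0 t ^ k) has_real_derivative real k * max 0 t ^ (k - 1)) (at t)"
proof (cases "t = 0")
  case False
  show ?thesis
  proof (cases "t > 0")
    case True
    have "((\<lambda>t. t ^ k) has_real_derivative real k * t ^ (k - 1)) (at t)"
      by (auto intro!: derivative_eq_intros)
    then have "((\<lambda>t. max 0 t ^ k) has_real_derivative real k * t ^ (k - 1)) (at t)"
      by (rule has_field_derivative_transform_within_open[where S = "{0<..}"]) (use True in auto)
    then show ?thesis using True by simp
  next
    case False2: False
    have "((\<lambda>t. 0) has_real_derivative 0) (at t)" by simp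
    then have "((\<lambda>t. max 0 t ^ k) has_real_derivative 0) (at t)"
      by (rule has_field_derivative_transform_within_open[where S = "{..<0}"])
         (use False False2 assms in auto)
    then show ?thesis using False False2 assms by (simp add: power_0_left max_def)
  qed
next
  case True
  \<comment> \<open>At the gluing point the difference quotient is at most
    \<open>max 0 h ^ (k - 1)\<close>, whose exponent is positive because
    \<open>2 \<le> k\<close>.\<close>
  have "((\<lambda>h. (max 0 h ^ k) / h) \<longlongrightarrow> 0) (at (0::real))"
  proof (rule Lim_null_comparison)
    show "\<forall>\<^sub>F h in at (0::real). norm (max 0 h ^ k / h) \<le> max 0 h ^ (k - 1)"
    proof (intro always_eventually allI)
      fix h :: real
      have "max 0 h ^ k = max 0 h * max 0 h ^ (k - 1)" using assms by (simp add: power_eq_if)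
      then show "norm (max 0 h ^ k / h) \<le> max 0 h ^ (k - 1)"
        by (cases "h > 0") (auto simp: max_def)
    qed
    have "((\<lambda>h. max 0 h ^ (k - 1)) \<longlongrightarrow> max 0 (0::real) ^ (k - 1)) (at 0)"
      by (intro tendsto_intros)
    then show "((\<lambda>h. max 0 h ^ (k - 1)) \<longlongrightarrow> 0) (at (0::real))"
      using assms by (simp add: power_0_left)
  qed
  then show ?thesis using True assms by (simp add: DERIV_def power_0_left)
qed

text \<open>With \<open>s = r - 2\<close>, \<open>a = norm x\<close>, \<open>b = norm y\<close>,
  symmetrisation writes the right hand side as
  \<open>(a^s + b^s)/2 * |x - y|^2 + (a^s - b^s)(a^2 - b^2)/2\<close>. The second summand is
  nonnegative, and \<open>|x - y| \<le> 2 max a b\<close> bounds the missing factor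
  \<open>|x - y|^s\<close> by \<open>2^s (a^s + b^s)\<close>; this accounts for the constant
  \<open>2^(1-r)\<close>.\<close>

lemma flux_strongly_monotone:
  fixes x y :: "'a::euclidean_space"
  assumes "2 < r"
  shows "2 powr (1 - r) * norm (x - y) powr r \<le> inner (flux r x - flux r y) (x - y)"
proof -
  define a b where "a = norm x" and "b = norm y"
  define s where "s = r - 2"
  have s: "s > 0" and ab: "a \<ge> 0" "b \<ge> 0" using assms by (auto simp: s_def a_def b_def)
  have xy: "inner x x = a^2" "inner y y = b^2" by (auto simp: a_def b_def dot_square_norm)
  have nn: "norm (x - y) ^ 2 = a^2 + b^2 - 2 * inner x y"
    using xy by (simp add: power2_norm_eq_inner inner_diff inner_commute)
  have "inner (flux r x - flux r y) (x - y)
      = a powr s * (a^2 - inner x y) - b powr s * (inner x y - b^2)"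
    using xy by (simp add: flux_def s_def a_def b_def inner_diff inner_commute right_diff_distrib)
  also have "\<dots> = (a powr s + b powr s) / 2 * norm (x - y)^2
      + (a powr s - b powr s) * (a^2 - b^2) / 2"
    unfolding nn by (simp add: field_simps)
  finally have eq: "inner (flux r x - flux r y) (x - y) = \<dots>" .
  have mono: "(a powr s - b powr s) * (a^2 - b^2) \<ge> 0"
  proof (cases "a \<le> b")
    case True
    then have "a powr s \<le> b powr s" "a^2 \<le> b^2" using ab s by (auto intro: powr_mono2 power_mono)
    then show ?thesis by (intro mult_nonpos_nonpos) auto
  next
    case False
    then have "b powr s \<le> a powr s" "b^2 \<le> a^2" using ab s by (auto intro: powr_mono2 power_mono)
    then show ?thesis by simp
  qed
  have "norm (x - y) \<le> 2 * max a b"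
    using norm_triangle_ineq4[of x y] by (auto simp: a_def b_def)
  then have "norm (x - y) powr s \<le> (2 * max a b) powr s"
    using s by (intro powr_mono2) auto
  also have "\<dots> = 2 powr s * max a b powr s" using ab by (simp add: powr_mult)
  also have "\<dots> \<le> 2 powr s * (a powr s + b powr s)"
    by (intro mult_left_mono) (auto simp: max_def)
  finally have A: "norm (x - y) powr s \<le> 2 powr s * (a powr s + b powr s)" .
  have "2 powr (1 - r) * norm (x - y) powr r = 2 powr (1 - r) * (norm (x - y)^2 * norm (x - y) powr s)"
  proof (cases "x = y")
    case False
    then have "norm (x - y) powr r = norm (x - y) powr 2 * norm (x - y) powr s"
      by (subst powr_add[symmetric]) (simp add: s_def)
    then show ?thesis using False by simp
  qed simp
  also have "\<dots> \<le> 2 powr (1 - r) * (norm (x - y)^2 * (2 powr s * (a powr s + b powr s)))"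
    by (intro mult_left_mono A) auto
  also have "\<dots> = (2 powr (1 - r) * 2 powr s) * ((a powr s + b powr s) * norm (x - y)^2)"
    by (simp add: field_simps)
  also have "2 powr (1 - r) * 2 powr s = (1/2 :: real)"
    by (simp add: s_def powr_add[symmetric] powr_minus_divide)
  finally show ?thesis unfolding eq using mono by simp
qed

lemma norm_flux: "norm (flux p z) = norm z powr (p - 1)"
  for z :: "'a::euclidean_space"
  by (cases "z = 0") (simp_all add: flux_def powr_mult_base[of "norm z", simplified] mult.commute)

lemma flux_flux_conjugate:
  fixes z :: "'a::euclidean_space"
  assumes "1 < p"
  shows "flux (p / (p - 1)) (flux p z) = z"
proof (cases "z = 0")
  case False
  have "(p - 1) * (p / (p - 1) - 2) + (p - 2) = 0" using assms by (simp add: field_simps)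
  then have "(norm z powr (p - 1)) powr (p / (p - 1) - 2) * norm z powr (p - 2) = 1"
    using False by (simp add: powr_powr powr_add[symmetric])
  then show ?thesis unfolding flux_def[of "p / (p - 1)"] norm_flux by (simp add: flux_def)
qed (simp add: flux_def)

text \<open>Strong monotonicity for the exponent \<open>p / (p - 1) > 2\<close>, evaluated at the
  two fluxes: since \<open>flux (p / (p - 1))\<close> inverts \<open>flux p\<close>, gradients and
  fluxes exchange their roles.\<close>

lemma norm_flux_diff_powr_le:
  fixes a b :: "'a::euclidean_space"
  assumes "1 < p" "p < 2"
  shows "2 powr (1 - p / (p - 1)) * norm (flux p a - flux p b) powr (p / (p - 1))
      \<le> inner (flux p a - flux p b) (a - b)"
proof -
  have "2 < p / (p - 1)" using assms by (simp add: field_simps)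
  from flux_strongly_monotone[OF this, of "flux p a" "flux p b"] show ?thesis
    by (simp add: flux_flux_conjugate[OF assms(1)] inner_commute)
qed

text \<open>On the real line \<open>\<bar>t\<bar> powr (q - 1) * t\<close> is
  \<open>flux (q + 1) t\<close>, so this is strong monotonicity divided by
  \<open>s - t\<close>.\<close>

lemma diff_signed_powr_ge:
  fixes s t :: real
  assumes "1 < q" "t < s"
  shows "2 powr (- q) * (s - t) powr q \<le> \<bar>s\<bar> powr (q - 1) * s - \<bar>t\<bar> powr (q - 1) * t"
proof -
  have "2 powr (- q) * (s - t) powr (q + 1) \<le> (\<bar>s\<bar> powr (q - 1) * s - \<bar>t\<bar> powr (q - 1) * t) * (s - t)"
    using flux_strongly_monotone[of "q + 1" s t] assms by (simp add: flux_def)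
  moreover have "(s - t) powr (q + 1) = (s - t) powr q * (s - t)"
    using assms by (simp add: powr_add)
  ultimately show ?thesis using assms by (simp add: mult.assoc[symmetric])
qed

text \<open>Young's inequality with the weights dropped: if \<open>m\<close> is the largest of the
  three powers, the factors are at most \<open>m^a\<close>, \<open>m^b\<close>, \<open>m^c\<close>,
  and these multiply to \<open>m\<close>.\<close>

lemma mult3_le_add_powr:
  fixes x y z a b c :: real
  assumes "0 \<le> x" "0 \<le> y" "0 \<le> z" "0 < a" "0 < b" "0 < c" "a + b + c = 1"
  shows "x * y * z \<le> x powr (1/a) + y powr (1/b) + z powr (1/c)"
proof -
  define m where "m = max (x powr (1/a)) (max (y powr (1/b)) (z powr (1/c)))"
  have m: "x powr (1/a) \<le> m" "y powr (1/b) \<le> m" "z powr (1/c) \<le> m" "0 \<le> m"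
    by (auto simp: m_def le_max_iff_disj)
  have "(x powr (1/a)) powr a \<le> m powr a" "(y powr (1/b)) powr b \<le> m powr b"
       "(z powr (1/c)) powr c \<le> m powr c" using m assms by (auto intro!: powr_mono2)
  then have "x \<le> m powr a" "y \<le> m powr b" "z \<le> m powr c"
    using assms by (auto simp: powr_powr)
  then have "x * y * z \<le> m powr a * m powr b * m powr c"
    using assms by (intro mult_mono) auto
  also have "\<dots> = m" using assms m by (simp add: powr_add[symmetric])
  also have "m \<le> x powr (1/a) + y powr (1/b) + z powr (1/c)"
    by (auto simp: m_def)
  finally show ?thesis .
qed

lemma mult_le_add_powr:
  fixes x y :: real
  assumes "0 \<le> x" "0 \<le> y" "1 < p"
  shows "x * y \<le> x powr (p / (p - 1)) + y powr p"
proof -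
  define m where "m = max (x powr (p / (p - 1))) (y powr p)"
  have m: "x powr (p / (p - 1)) \<le> m" "y powr p \<le> m" "0 \<le> m"
    by (auto simp: m_def le_max_iff_disj)
  have "(x powr (p / (p - 1))) powr ((p - 1) / p) \<le> m powr ((p - 1) / p)"
    "(y powr p) powr (1 / p) \<le> m powr (1 / p)"
    using m assms by (auto intro!: powr_mono2)
  then have "x \<le> m powr ((p - 1) / p)" "y \<le> m powr (1 / p)" using assms by (auto simp: powr_powr)
  then have "x * y \<le> m powr ((p - 1) / p) * m powr (1 / p)" using assms by (intro mult_mono) auto
  also have "\<dots> = m" using assms m by (simp add: powr_add[symmetric] add_divide_distrib[symmetric])
  finally show ?thesis by (auto simp: m_def max_def split: if_splits intro: order_trans)
qed

text \<open>Supporting lines of a convex power; integrated against a mollifier they yield Jensen's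
  inequality in \<open>norm_conv_mollifier_powr_le\<close>.\<close>

lemma powr_above_tangent:
  fixes a t :: real
  assumes "1 < p" "0 < a" "0 \<le> t"
  shows "a powr p + p * a powr (p - 1) * (t - a) \<le> t powr p"
proof (cases "t = 0")
  case True
  have "a powr p + p * a powr (p - 1) * (0 - a) = (1 - p) * a powr p"
    using assms by (simp add: powr_diff field_simps)
  also have "\<dots> \<le> 0" using assms by (intro mult_nonpos_nonneg) auto
  finally show ?thesis using True by simp
next
  case False
  have "p * a powr (p - 1) * (t - a) \<le> t powr p - a powr p"
  proof (rule convex_on_imp_above_tangent[where A = "{0<..}" and f = "\<lambda>x. x powr p"])
    show "convex_on {0<..} (\<lambda>x. x powr p)"
      using assms by (intro convex_on_subset[OF powr_convex]) auto
    show "((\<lambda>x. x powr p) has_real_derivative p * a powr (p - 1)) (at a within {0<..})"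
      using assms by (auto intro!: derivative_eq_intros)
  qed (use assms False in \<open>auto simp: interior_open\<close>)
  then show ?thesis by simp
qed

text \<open>The last condition is what \<open>young_absorption\<close> needs to split
  \<open>T\<close> among its factors. The witness is \<open>1 - (1 + t^k)^(-\<sigma>)\<close> on
  positive \<open>t\<close>. Near \<open>0\<close> it behaves like \<open>t^k\<close> and its
  derivative like \<open>t^(k-1)\<close>, so a large \<open>k\<close> suffices; at infinity
  \<open>T\<close> tends to \<open>1\<close> and \<open>T'\<close> decays like
  \<open>t^(-k\<sigma>-1)\<close>, so \<open>k\<sigma>\<close> has to be small. The hypothesis
  relating \<open>p\<close>, \<open>q\<close> and \<open>M\<close> leaves room for a positive
  \<open>\<sigma>\<close>.\<close>

lemma exists_test_profile:
  fixes p q M :: real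
  assumes p: "1 < p" and M: "0 < M" and pq: "(p - 1) / p < q / p - q / M"
  shows "\<exists>T T' C. (\<forall>t. (T has_real_derivative T' t) (at t)) \<and> continuous_on UNIV T' \<and>
     (\<forall>t. 0 \<le> T t \<and> T t \<le> 1 \<and> 0 \<le> T' t \<and> T' t \<le> C) \<and>
     (\<forall>t. 0 < t \<longrightarrow> 0 < T t) \<and> (\<forall>t\<le>0. T t = 0 \<and> T' t = 0) \<and> 0 < C \<and>
     (\<forall>t>0. T t powr ((p - 1) / p + 1 / M) \<le> C * t powr (q / p - q / M) * T' t powr ((p - 1) / p))"
proof -
  define \<alpha> \<beta> where "\<alpha> = (p - 1) / p" and "\<beta> = q / p - q / M"
  have \<alpha>: "0 < \<alpha>" "\<alpha> < \<beta>" using assms by (auto simp: \<alpha>_def \<beta>_def)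
  \<comment> \<open>\<open>k > M * \<beta>\<close> settles the condition near \<open>0\<close>; the
    added \<open>2\<close> makes the profile continuously differentiable at
    \<open>0\<close>.\<close>
  obtain k0 :: nat where k0: "M * \<beta> < real k0" using reals_Archimedean2 by blast
  define k where "k = k0 + 2"
  have k: "2 \<le> k" "M * \<beta> < real k" using k0 by (auto simp: k_def)
  \<comment> \<open>The solution of \<open>(k * \<sigma> + 1) * \<alpha> = \<beta>\<close>: with it
    the decay of \<open>T' powr \<alpha>\<close> at infinity exactly balances the growth of
    \<open>t powr \<beta>\<close>. It is positive because \<open>\<alpha> < \<beta>\<close>.\<close>
  define \<sigma> where "\<sigma> = (\<beta> / \<alpha> - 1) / k"
  have \<sigma>: "0 < \<sigma>" using \<alpha> k by (auto simp: \<sigma>_def field_simps)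
  have k\<sigma>: "(k * \<sigma> + 1) * \<alpha> = \<beta>" using \<alpha> k by (auto simp: \<sigma>_def field_simps)
  define T where "T t = 1 - (1 + max 0 t ^ k) powr (- \<sigma>)" for t :: real
  define T' where "T' t = \<sigma> * k * max 0 t ^ (k - 1) * (1 + max 0 t ^ k) powr (- \<sigma> - 1)" for t :: real
  have pos: "0 < 1 + max 0 t ^ k" for t :: real
    by (simp add: add_pos_nonneg)
  have der: "(T has_real_derivative T' t) (at t)" for t
  proof -
    have "((\<lambda>t. 1 + max 0 t ^ k) has_real_derivative 0 + k * max 0 t ^ (k - 1)) (at t)"
      by (intro DERIV_add DERIV_const DERIV_pos_part_power k)
    from DERIV_diff[OF DERIV_const DERIV_fun_powr[OF this pos, of "- \<sigma>"], of 1] show ?thesis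
      by (simp add: T_def[abs_def] T'_def mult_ac)
  qed
  have cont: "continuous_on UNIV T'"
    unfolding T'_def[abs_def] using pos by (intro continuous_intros) (metis less_irrefl)
  have T01: "0 \<le> T t \<and> T t \<le> 1" for t
    using pos[of t] \<sigma> powr_mono[of "-\<sigma>" 0 "1 + max 0 t ^ k"] by (auto simp: T_def)
  have T'0: "0 \<le> T' t" for t using \<sigma> by (auto simp: T'_def)
  have T'le: "T' t \<le> \<sigma> * k" for t
  proof -
    have "max 0 t ^ (k - 1) \<le> 1 + max 0 t ^ k"
    proof (cases "t \<le> 1")
      case True
      then have "max 0 t ^ (k - 1) \<le> 1" by (intro power_le_one) auto
      then show ?thesis by (smt (verit) zero_le_power max.cobounded1)
    next
      case False
      then have "max 0 t ^ (k - 1) \<le> max 0 t ^ k" by (intro power_increasing) auto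
      then show ?thesis by simp
    qed
    moreover have "(1 + max 0 t ^ k) powr (- \<sigma> - 1) \<le> (1 + max 0 t ^ k) powr (- 1)"
      using \<sigma> by (intro powr_mono) auto
    ultimately have "max 0 t ^ (k - 1) * (1 + max 0 t ^ k) powr (- \<sigma> - 1)
       \<le> (1 + max 0 t ^ k) * (1 + max 0 t ^ k) powr (- 1)"
      by (intro mult_mono) auto
    also have "\<dots> = 1" using pos[of t] by (simp add: powr_minus_divide)
    finally show ?thesis using \<sigma> mult_left_mono[of _ 1 "\<sigma> * k"] by (simp add: T'_def mult.assoc)
  qed
  have Tpos: "0 < T t" if "0 < t" for t
    using that \<sigma> k powr_less_mono[of "-\<sigma>" 0 "1 + t ^ k"] by (auto simp: T_def max_def split: if_splits)
  have Tneg: "T t = 0 \<and> T' t = 0" if "t \<le> 0" for t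
    using that k by (auto simp: T_def T'_def max_def power_0_left)
  \<comment> \<open>Bernoulli's inequality for a negative exponent, obtained from
    \<open>1 + y \<le> exp y\<close> and \<open>ln (1 + y) \<le> y\<close>.\<close>
  have Tsmall: "T t \<le> \<sigma> * t ^ k" if "0 < t" for t
  proof -
    have "1 + (- \<sigma>) * t ^ k \<le> exp ((- \<sigma>) * t ^ k)" by (rule exp_ge_add_one_self)
    also have "\<dots> \<le> exp ((- \<sigma>) * ln (1 + t ^ k))"
      using that \<sigma> ln_add_one_self_le_self[of "t ^ k"] by simp
    also have "\<dots> = (1 + t ^ k) powr (- \<sigma>)"
      using pos[of t] that by (simp add: powr_def max_def)
    finally show ?thesis using that by (simp add: T_def max_def)
  qed
  \<comment> \<open>The factor \<open>2 powr (- \<sigma> - 1)\<close> serves both ranges of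
    \<open>t\<close>: \<open>1 + t ^ k\<close> is at most \<open>2\<close> for
    \<open>t \<le> 1\<close> and at most \<open>2 * t ^ k\<close> for
    \<open>t \<ge> 1\<close>.\<close>
  define c where "c = (\<sigma> * k * 2 powr (- \<sigma> - 1)) powr \<alpha>"
  have c: "0 < c" using \<sigma> k by (simp add: c_def)
  define C where "C = max (\<sigma> * k) (max (1 / c) (\<sigma> powr (\<alpha> + 1 / M) / c))"
  have C: "\<sigma> * k \<le> C" "1 \<le> C * c" "\<sigma> powr (\<alpha> + 1 / M) \<le> C * c"
    using c by (auto simp: C_def max_def field_simps)
  have "0 < \<sigma> * k" using \<sigma> k by simp
  then have C0: "0 < C" using C(1) by linarith
  have key: "T t powr (\<alpha> + 1 / M) \<le> C * t powr \<beta> * T' t powr \<alpha>" if t: "0 < t" for t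
  proof (cases "t \<le> 1")
    case True
    have "T t powr (\<alpha> + 1 / M) \<le> (\<sigma> * t ^ k) powr (\<alpha> + 1 / M)"
      using Tsmall[OF t] T01 \<alpha> M by (intro powr_mono2) auto
    also have "\<dots> = \<sigma> powr (\<alpha> + 1 / M) * t powr (k * (\<alpha> + 1 / M))"
      using t \<sigma> by (simp add: powr_mult powr_realpow[symmetric] powr_powr)
    \<comment> \<open>For \<open>t \<le> 1\<close> the smaller exponent gives the larger power, so
      it remains to compare exponents; the choice of \<open>k\<close> gives
      \<open>\<beta> \<le> k / M\<close>.\<close>
    also have "\<dots> \<le> (C * c) * t powr (\<beta> + (k - 1) * \<alpha>)"
    proof (intro mult_mono C powr_mono')
      have "\<beta> \<le> k / M" using k M by (simp add: field_simps)
      then have "\<beta> + (k - 1) * \<alpha> \<le> k / M + k * \<alpha>" using \<alpha> by (intro add_mono mult_right_mono) auto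
      also have "\<dots> = k * (\<alpha> + 1 / M)" by (simp add: algebra_simps)
      finally show "\<beta> + (k - 1) * \<alpha> \<le> k * (\<alpha> + 1 / M)" .
    qed (use t True C0 c in auto)
    also have "\<dots> = C * t powr \<beta> * (\<sigma> * k * t ^ (k - 1) * 2 powr (- \<sigma> - 1)) powr \<alpha>"
      using t \<sigma> k by (simp add: c_def powr_mult powr_realpow[symmetric] powr_powr powr_add
          of_nat_diff mult_ac)
    also have "\<dots> \<le> C * t powr \<beta> * T' t powr \<alpha>"
    proof -
      have "t ^ k \<le> 1" using t True by (intro power_le_one) auto
      then have "2 powr (- \<sigma> - 1) \<le> (1 + t ^ k) powr (- \<sigma> - 1)"
        using \<sigma> t by (intro powr_mono2') (auto simp: add_pos_nonneg)
      then show ?thesis using t \<sigma> C0 \<alpha> unfolding T'_def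
        by (intro mult_left_mono powr_mono2) (auto simp: max_def intro!: mult_left_mono)
    qed
    finally show ?thesis .
  next
    case False
    \<comment> \<open>For large \<open>t\<close> only \<open>T \<le> 1\<close> is used; the rest of
      the chain rewrites the constant \<open>c\<close> as \<open>c * t powr (- \<beta>)\<close>
      times \<open>t powr \<beta>\<close> and recognises the lower bound for \<open>T'\<close> in
      it.\<close>
    have "T t powr (\<alpha> + 1 / M) \<le> 1"
      using T01[of t] \<alpha> M by (intro powr_le1) auto
    also have "1 \<le> C * c" by fact
    also have "\<dots> = C * t powr \<beta> * (c * t powr (- \<beta>))"
      using t by (simp add: powr_minus field_simps)
    also have "c * t powr (- \<beta>) = (\<sigma> * k * 2 powr (- \<sigma> - 1) * (t powr (- (k * \<sigma> + 1)))) powr \<alpha>"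
      unfolding k\<sigma>[symmetric] using t \<sigma> k by (simp add: c_def powr_mult powr_powr algebra_simps)
    also have "- (k * \<sigma> + 1) = (k - 1) + k * (- \<sigma> - 1)" using k by (simp add: algebra_simps of_nat_diff)
    also have "t powr ((k - 1) + k * (- \<sigma> - 1)) = t ^ (k - 1) * (t ^ k) powr (- \<sigma> - 1)"
      using t k by (simp add: powr_add powr_realpow[symmetric] powr_powr of_nat_diff)
    also have "\<sigma> * k * 2 powr (- \<sigma> - 1) * (t ^ (k - 1) * (t ^ k) powr (- \<sigma> - 1))
        = \<sigma> * k * t ^ (k - 1) * (2 * t ^ k) powr (- \<sigma> - 1)"
      using t by (simp add: powr_mult mult_ac)
    also have "C * t powr \<beta> * (\<sigma> * k * t ^ (k - 1) * (2 * t ^ k) powr (- \<sigma> - 1)) powr \<alpha>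
        \<le> C * t powr \<beta> * T' t powr \<alpha>"
    proof -
      have "1 \<le> t ^ k" using False by (intro one_le_power) auto
      then have "(2 * t ^ k) powr (- \<sigma> - 1) \<le> (1 + t ^ k) powr (- \<sigma> - 1)"
        using \<sigma> t by (intro powr_mono2') (auto simp: add_pos_nonneg)
      then show ?thesis using t \<sigma> C0 \<alpha> unfolding T'_def
        by (intro mult_left_mono powr_mono2) (auto simp: max_def intro!: mult_left_mono)
    qed
    finally show ?thesis .
  qed
  have T'C: "T' t \<le> C" for t using T'le[of t] C(1) by linarith
  show ?thesis
    using der cont T01 T'0 T'C Tpos Tneg key C0
    unfolding \<alpha>_def \<beta>_def by (intro exI[of _ T] exI[of _ T'] exI[of _ C]) simp
qed

section \<open>Mollification\<close>

lemma sigma_finite_lebesgue: "sigma_finite_measure (lebesgue :: 'a::euclidean_space measure)"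
proof
  let ?A = "range (\<lambda>n::nat. cball (0::'a) (real n))"
  have "x \<in> \<Union> ?A" for x :: 'a
    using real_arch_simple[of "norm x"] by auto
  moreover have "emeasure lebesgue (cball (0::'a) (real n)) \<noteq> \<infinity>" for n :: nat
    using emeasure_compact_finite[OF compact_cball, of "0::'a" "real n"] by auto
  ultimately show "\<exists>A. countable A \<and> A \<subseteq> sets lebesgue \<and> \<Union> A = space (lebesgue :: 'a measure) \<and>
      (\<forall>a\<in>A. emeasure lebesgue a \<noteq> \<infinity>)"
    by (intro exI[of _ ?A]) auto
qed

interpretation lebesgue_pair: pair_sigma_finite
    "lebesgue :: 'a::euclidean_space measure" "lebesgue :: 'a::euclidean_space measure"
  by (simp add: pair_sigma_finite_def sigma_finite_lebesgue)

lemma borel_measurable_lebesgue_continuous: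
  fixes f :: "'a::euclidean_space \<Rightarrow> 'b::euclidean_space"
  shows "continuous_on UNIV f \<Longrightarrow> f \<in> borel_measurable lebesgue"
  by (simp add: borel_measurable_continuous_onI measurable_completion)

lemma Lloc_1_iff:
  "f \<in> Lloc 1 \<longleftrightarrow> f \<in> borel_measurable lebesgue \<and>
    (\<forall>K. compact K \<longrightarrow> set_integrable lebesgue K f)"
proof -
  have "set_integrable lebesgue K (\<lambda>x. norm (f x) powr 1) \<longleftrightarrow> set_integrable lebesgue K f"
    if "f \<in> borel_measurable lebesgue" "compact K" for K
  proof -
    have [measurable]: "f \<in> borel_measurable lebesgue" "K \<in> sets lebesgue"
      using that by (auto simp: compact_imp_closed)
    have "integrable lebesgue (\<lambda>x. norm (indicator K x *\<^sub>R f x))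
        \<longleftrightarrow> integrable lebesgue (\<lambda>x. indicator K x *\<^sub>R f x)"
      by (rule integrable_norm_iff) measurable
    then show ?thesis by (simp add: set_integrable_def)
  qed
  then show ?thesis by (auto simp: Lloc_def)
qed

lemma Lloc_imp_Lloc_1: "f \<in> Lloc p \<Longrightarrow> (\<lambda>x. norm (f x) powr p) \<in> Lloc 1"
  by (auto simp: Lloc_1_iff Lloc_def)

lemma continuous_imp_Lloc_1:
  fixes f :: "'a::euclidean_space \<Rightarrow> 'b::euclidean_space"
  assumes "continuous_on UNIV f"
  shows "f \<in> Lloc 1"
proof -
  have "set_integrable lebesgue K f" if "compact K" for K
    using borel_integrable_compact[OF that continuous_on_subset[OF assms], simplified]
    by (simp add: set_integrable_def integrable_completion borel_measurable_scaleR indicator_def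
        borel_measurable_continuous_onI[OF assms] if_distrib[where f = "\<lambda>c. c *\<^sub>R _"] cong: if_cong)
  then show ?thesis using borel_measurable_lebesgue_continuous[OF assms] by (simp add: Lloc_1_iff)
qed

lemma Lloc_1_diff:
  assumes "f \<in> Lloc 1" "g \<in> Lloc 1"
  shows "(\<lambda>x. f x - g x) \<in> Lloc 1"
  using assms by (auto simp: Lloc_1_iff set_integral_diff)

lemma integrable_scaleR_Lloc_1:
  fixes k :: "'a::euclidean_space \<Rightarrow> real" and f :: "'a \<Rightarrow> 'b::euclidean_space"
  assumes f: "f \<in> Lloc 1" and [measurable]: "k \<in> borel_measurable lebesgue"
    and B: "\<And>x. \<bar>k x\<bar> \<le> B" and S: "compact S" "\<forall>x. x \<notin> S \<longrightarrow> k x = 0"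
  shows "integrable lebesgue (\<lambda>x. k x *\<^sub>R f x)"
proof (rule Bochner_Integration.integrable_bound)
  show "integrable lebesgue (\<lambda>x. B *\<^sub>R (indicator S x *\<^sub>R f x))"
    using f S by (intro integrable_scaleR_right) (auto simp: Lloc_1_iff set_integrable_def)
  have [measurable]: "f \<in> borel_measurable lebesgue" using f by (simp add: Lloc_1_iff)
  show "(\<lambda>x. k x *\<^sub>R f x) \<in> borel_measurable lebesgue" by measurable
  have "norm (k x *\<^sub>R f x) \<le> norm (B *\<^sub>R (indicator S x *\<^sub>R f x))" for x
  proof (cases "x \<in> S")
    case True
    have "\<bar>k x\<bar> * norm (f x) \<le> \<bar>B\<bar> * norm (f x)"
      using B[of x] by (intro mult_right_mono) auto
    then show ?thesis using True by simp
  qed (use S in auto)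
  then show "AE x in lebesgue. norm (k x *\<^sub>R f x) \<le> norm (B *\<^sub>R (indicator S x *\<^sub>R f x))"
    by simp
qed

lemma norm_integral_scaleR_Lloc_1_le:
  fixes k :: "'a::euclidean_space \<Rightarrow> real" and f :: "'a \<Rightarrow> 'b::euclidean_space"
  assumes f: "f \<in> Lloc 1" and k: "k \<in> borel_measurable lebesgue"
    and B: "\<And>x. \<bar>k x\<bar> \<le> B" and S: "compact S" "\<forall>x. x \<notin> S \<longrightarrow> k x = 0"
  shows "norm (\<integral>x. k x *\<^sub>R f x \<partial>lebesgue) \<le> B * (\<integral>x. norm (indicator S x *\<^sub>R f x) \<partial>lebesgue)"
proof -
  have int: "integrable lebesgue (\<lambda>x. indicator S x *\<^sub>R f x)"
    using f S by (auto simp: Lloc_1_iff set_integrable_def)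
  have "norm (\<integral>x. k x *\<^sub>R f x \<partial>lebesgue) \<le> (\<integral>x. norm (k x *\<^sub>R f x) \<partial>lebesgue)"
    by (rule integral_norm_bound)
  also have "\<dots> \<le> (\<integral>x. B * norm (indicator S x *\<^sub>R f x) \<partial>lebesgue)"
  proof (intro integral_mono integrable_norm integrable_scaleR_Lloc_1[OF f k B S] integrable_mult_right int)
    fix x
    show "norm (k x *\<^sub>R f x) \<le> B * norm (indicator S x *\<^sub>R f x)"
      using B[of x] S(2) by (cases "x \<in> S") (auto intro: mult_right_mono)
  qed
  also have "\<dots> = B * (\<integral>x. norm (indicator S x *\<^sub>R f x) \<partial>lebesgue)" by simp
  finally show ?thesis .
qed

text \<open>Enlarging the ball by \<open>1\<close> and capping the modulus at \<open>1\<close>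
  leaves two cases for nearby points: both in the larger ball, where compactness applies, or both
  outside the support.\<close>

lemma uniformly_continuous_on_UNIV_compact_support:
  fixes k :: "'a::euclidean_space \<Rightarrow> 'b::real_normed_vector"
  assumes "continuous_on UNIV k" and z: "\<forall>x. x \<notin> cball 0 r \<longrightarrow> k x = 0"
  shows "uniformly_continuous_on UNIV k"
proof (unfold uniformly_continuous_on_def, intro allI impI)
  fix e :: real assume e: "e > 0"
  have "uniformly_continuous_on (cball 0 (r + 1)) k"
    using assms(1) by (intro compact_uniformly_continuous) (auto intro: continuous_on_subset)
  with e obtain d where d: "d > 0"
    "\<And>x y. x \<in> cball 0 (r + 1) \<Longrightarrow> y \<in> cball 0 (r + 1) \<Longrightarrow> dist y x < d \<Longrightarrow> dist (k y) (k x) < e"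
    unfolding uniformly_continuous_on_def by meson
  have "dist (k y) (k x) < e" if "dist y x < min d 1" for x y
  proof (cases "x \<in> cball 0 r \<or> y \<in> cball 0 r")
    case True
    then have "x \<in> cball 0 (r + 1)" "y \<in> cball 0 (r + 1)"
      using that dist_triangle[of 0 x y] dist_triangle[of 0 y x] by (auto simp: dist_commute)
    then show ?thesis using d that by simp
  next
    case False
    then show ?thesis using z e by auto
  qed
  then show "\<exists>d>0. \<forall>x\<in>UNIV. \<forall>x'\<in>UNIV. dist x' x < d \<longrightarrow> dist (k x') (k x) < e"
    using d(1) by (intro exI[of _ "min d 1"]) auto
qed

lemma bounded_compact_support:
  fixes k :: "'a::euclidean_space \<Rightarrow> 'b::real_normed_vector"
  assumes "continuous_on UNIV k" "compact S" and z: "\<forall>x. x \<notin> S \<longrightarrow> k x = 0"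
  shows "\<exists>B\<ge>0. \<forall>x. norm (k x) \<le> B"
proof -
  have "compact (k ` S)"
    using assms by (intro compact_continuous_image) (auto intro: continuous_on_subset)
  then have "bounded (k ` S)" by (rule compact_imp_bounded)
  then obtain B where B: "B > 0" "\<And>x. x \<in> S \<Longrightarrow> norm (k x) \<le> B"
    unfolding bounded_pos by blast
  then show ?thesis using z by (intro exI[of _ B]) fastforce
qed

section \<open>Convolution with a compactly supported kernel\<close>

definition conv :: "('a::euclidean_space \<Rightarrow> real) \<Rightarrow> ('a \<Rightarrow> 'b::euclidean_space) \<Rightarrow> 'a \<Rightarrow> 'b" where
  "conv k f x = (\<integral>y. k (x - y) *\<^sub>R f y \<partial>lebesgue)"

lemma kernel_translate:
  fixes k :: "'a::euclidean_space \<Rightarrow> 'b::euclidean_space"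
  assumes "continuous_on UNIV k" "\<forall>z. z \<notin> cball 0 r \<longrightarrow> k z = 0"
  shows "(\<lambda>y. k (x - y)) \<in> borel_measurable lebesgue" "\<exists>B\<ge>0. \<forall>y. norm (k (x - y)) \<le> B"
    "\<forall>y. y \<notin> cball x r \<longrightarrow> k (x - y) = 0" "continuous_on UNIV (\<lambda>y. k (x - y))"
proof -
  show c: "continuous_on UNIV (\<lambda>y. k (x - y))"
    using assms(1) by (intro continuous_on_compose2[OF assms(1)] continuous_intros) auto
  then show "(\<lambda>y. k (x - y)) \<in> borel_measurable lebesgue"
    by (rule borel_measurable_lebesgue_continuous)
  show "\<exists>B\<ge>0. \<forall>y. norm (k (x - y)) \<le> B"
    using bounded_compact_support[OF assms(1) compact_cball assms(2)] by blast
  show "\<forall>y. y \<notin> cball x r \<longrightarrow> k (x - y) = 0"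
    using assms(2) by (auto simp: dist_norm)
qed

lemma conv_integrable:
  fixes k :: "'a::euclidean_space \<Rightarrow> real" and f :: "'a \<Rightarrow> 'b::euclidean_space"
  assumes "f \<in> Lloc 1" "continuous_on UNIV k" "\<forall>z. z \<notin> cball 0 r \<longrightarrow> k z = 0"
  shows "integrable lebesgue (\<lambda>y. k (x - y) *\<^sub>R f y)"
proof -
  note K = kernel_translate[OF assms(2,3), where x = x]
  from K(2) obtain B where "\<And>y. \<bar>k (x - y)\<bar> \<le> B" by auto
  then show ?thesis by (rule integrable_scaleR_Lloc_1[OF assms(1) K(1) _ compact_cball K(3)])
qed

text \<open>For \<open>x\<close> within distance \<open>1\<close> of \<open>x0\<close> both
  translated kernels live on \<open>cball x0 (r + 1)\<close>, where \<open>f\<close> is integrable,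
  and they differ uniformly little. The \<open>+ 1\<close> in the denominator of \<open>e'\<close>
  covers the case that the integral of \<open>f\<close> vanishes there.\<close>

lemma continuous_on_conv:
  fixes k :: "'a::euclidean_space \<Rightarrow> real" and f :: "'a \<Rightarrow> 'b::euclidean_space"
  assumes f: "f \<in> Lloc 1" and k: "continuous_on UNIV k" "\<forall>z. z \<notin> cball 0 r \<longrightarrow> k z = 0"
  shows "continuous_on UNIV (conv k f)"
proof (unfold continuous_on_iff, intro ballI allI impI)
  fix x0 :: 'a and e :: real assume e: "0 < e"
  define I where "I = (\<integral>y. norm (indicator (cball x0 (r + 1)) y *\<^sub>R f y) \<partial>lebesgue)"
  have I: "0 \<le> I" by (auto simp: I_def)
  define e' where "e' = e / (I + 1)"
  have e': "0 < e'" "e' * I < e" using e I by (auto simp: e'_def field_simps)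
  from uniformly_continuous_on_UNIV_compact_support[OF k] e'(1) obtain d where d: "d > 0"
    "\<And>x y. dist y x < d \<Longrightarrow> dist (k y) (k x) < e'"
    unfolding uniformly_continuous_on_def by auto
  have "dist (conv k f x) (conv k f x0) < e" if x: "dist x x0 < min d 1" for x
  proof -
    have "conv k f x - conv k f x0 = (\<integral>y. (k (x - y) - k (x0 - y)) *\<^sub>R f y \<partial>lebesgue)"
      unfolding conv_def
      by (simp add: scaleR_diff_left Bochner_Integration.integral_diff conv_integrable[OF f k])
    also have "norm \<dots> \<le> e' * I" unfolding I_def
    proof (rule norm_integral_scaleR_Lloc_1_le[OF f _ _ compact_cball])
      show "(\<lambda>y. k (x - y) - k (x0 - y)) \<in> borel_measurable lebesgue"
        using kernel_translate(1)[OF k] by measurable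
      show "\<bar>k (x - y) - k (x0 - y)\<bar> \<le> e'" for y
        using d(2)[of "x - y" "x0 - y"] x by (auto simp: dist_norm)
      show "\<forall>y. y \<notin> cball x0 (r + 1) \<longrightarrow> k (x - y) - k (x0 - y) = 0"
      proof (intro allI impI)
        fix y assume y: "y \<notin> cball x0 (r + 1)"
        have "dist x0 y \<le> dist x0 x + dist x y" by (rule dist_triangle)
        then have "y \<notin> cball x r" "y \<notin> cball x0 r" using x y by (auto simp: dist_commute)
        then show "k (x - y) - k (x0 - y) = 0" using kernel_translate(3)[OF k] by simp
      qed
    qed
    finally show ?thesis using e' by (simp add: dist_norm)
  qed
  then show "\<exists>d>0. \<forall>x'\<in>UNIV. dist x' x0 < d \<longrightarrow> dist (conv k f x') (conv k f x0) < e"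
    using d(1) by (intro exI[of _ "min d 1"]) auto
qed

lemma C1_0I:
  assumes g: "\<And>x. GDERIV \<phi> x :> g x" "continuous_on UNIV g"
    and S: "compact S" "\<forall>x. x \<notin> S \<longrightarrow> \<phi> x = 0"
  shows "\<phi> \<in> C1_0"
proof -
  have "grad \<phi> = g" using grad_eqI[OF g(1)] by auto
  moreover have "\<phi> differentiable (at x)" for x
    using g(1)[of x] unfolding gderiv_def differentiable_def by blast
  moreover have "closure (support_on UNIV \<phi>) \<subseteq> S"
    using S by (intro closure_minimal) (auto simp: support_on_def compact_imp_closed)
  then have "compact (closure (support_on UNIV \<phi>))"
    using S(1) by (metis closed_closure compact_Int_closed inf.absorb_iff2)
  ultimately show ?thesis using g(2) by (simp add: C1_0_def)
qed

text \<open>The mean value theorem for \<open>k\<close> minus its linear part at \<open>a\<close>.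
  Since the remainder is controlled by the oscillation of the gradient alone, uniform continuity of
  the gradient makes it uniform in \<open>a\<close>.\<close>

lemma GDERIV_linearization_le:
  fixes k :: "'a::euclidean_space \<Rightarrow> real"
  assumes g: "\<And>x. GDERIV k x :> g x"
    and B: "\<And>t. t \<in> {0..1} \<Longrightarrow> norm (g (a + t *\<^sub>R h) - g a) \<le> B"
  shows "\<bar>k (a + h) - k a - inner h (g a)\<bar> \<le> norm h * B"
proof -
  let ?S = "closed_segment a (a + h)"
  have S: "x \<in> ?S \<Longrightarrow> \<exists>t\<in>{0..1}. x = a + t *\<^sub>R h" for x
    by (auto simp: closed_segment_def algebra_simps)
  have "norm (k (a + h) - k a - (\<lambda>v. inner v (g a)) ((a + h) - a)) \<le> norm ((a + h) - a) * B"
  proof (rule differentiable_bound_linearization[where S = ?S and f' = "\<lambda>x v. inner v (g x)"])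
    show "a + t *\<^sub>R (a + h - a) \<in> ?S" if "t \<in> {0..1}" for t
      using that by (auto simp: closed_segment_def algebra_simps intro!: exI[of _ t])
    show "(k has_derivative (\<lambda>v. inner v (g x))) (at x within ?S)" for x
      using g[of x] unfolding gderiv_def by (rule has_derivative_at_withinI)
    show "onorm ((\<lambda>v. inner v (g x)) - (\<lambda>v. inner v (g a))) \<le> B" if "x \<in> ?S" for x
    proof -
      from S[OF that] obtain t where "t \<in> {0..1}" "x = a + t *\<^sub>R h" by blast
      with B[of t] have "norm (g x - g a) \<le> B" by simp
      then show ?thesis
        by (intro onorm_le) (simp add: inner_diff_right[symmetric] mult.commute[of B]
            order_trans[OF Cauchy_Schwarz_ineq2] mult_left_mono)
    qed
  qed auto
  then show ?thesis by simp
qed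

text \<open>The function \<open>k (x - y)\<close> of \<open>y\<close> is an admissible test function
  with gradient \<open>- g (x - y)\<close>, so the weak gradient identity turns
  \<open>conv k G x\<close> into the integral of \<open>w y\<close> times \<open>g (x - y)\<close>.
  This is the derivative of \<open>conv k w\<close> because the kernel has a first order expansion
  that is uniform in \<open>y\<close>.\<close>

lemma GDERIV_conv:
  fixes k :: "'a::euclidean_space \<Rightarrow> real" and w :: "'a \<Rightarrow> real"
  assumes w: "weak_gradient w G" and k: "\<forall>z. z \<notin> cball 0 r \<longrightarrow> k z = 0"
    and g: "\<And>z. GDERIV k z :> g z" "continuous_on UNIV g" "\<forall>z. z \<notin> cball 0 r \<longrightarrow> g z = 0"
  shows "GDERIV (conv k w) x :> conv k G x"
proof -
  have w1: "w \<in> Lloc 1" using w by (simp add: weak_gradient_def)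
  have ck: "continuous_on UNIV k"
    using g(1) unfolding gderiv_def by (meson continuous_at_imp_continuous_on has_derivative_continuous)
  let ?\<phi> = "\<lambda>y. k (x - y)"
  have der: "GDERIV ?\<phi> y :> - g (x - y)" for y
  proof -
    have "(k has_derivative (\<lambda>h. inner h (g (x - y)))) (at (x - y))"
      using g(1) unfolding gderiv_def .
    then have "((\<lambda>y. k (x - y)) has_derivative (\<lambda>h. inner (- h) (g (x - y)))) (at y)"
      by (rule has_derivative_compose[rotated]) (auto intro!: derivative_eq_intros)
    then show ?thesis unfolding gderiv_def by simp
  qed
  have "continuous_on UNIV (\<lambda>y. - g (x - y))"
    by (intro continuous_intros kernel_translate(4)[OF g(2,3)])
  with der have "?\<phi> \<in> C1_0"
    by (rule C1_0I[OF _ _ compact_cball]) (use kernel_translate(3)[OF ck k] in auto)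
  then have "(\<integral>y. w y *\<^sub>R grad ?\<phi> y \<partial>lebesgue) = - (\<integral>y. ?\<phi> y *\<^sub>R G y \<partial>lebesgue)"
    using w by (simp add: weak_gradient_def)
  then have eq: "conv k G x = (\<integral>y. w y *\<^sub>R g (x - y) \<partial>lebesgue)"
    unfolding conv_def grad_eqI[OF der] by simp
  have intw: "integrable lebesgue (\<lambda>y. w y *\<^sub>R g (x - y))"
  proof -
    note K = kernel_translate[OF g(2,3), where x = x]
    obtain B where B: "B \<ge> 0" "\<And>y. norm (g (x - y)) \<le> B" using K(2) by auto
    show ?thesis
    proof (rule Bochner_Integration.integrable_bound)
      show "integrable lebesgue (\<lambda>y. B * (indicator (cball x r) y *\<^sub>R w y))"
        using w1 by (auto simp: Lloc_1_iff set_integrable_def)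
      have [measurable]: "w \<in> borel_measurable lebesgue" using w1 by (simp add: Lloc_1_iff)
      show "(\<lambda>y. w y *\<^sub>R g (x - y)) \<in> borel_measurable lebesgue" using K(1) by measurable
      have "norm (w y *\<^sub>R g (x - y)) \<le> norm (B * (indicator (cball x r) y *\<^sub>R w y))" for y
        using B(1) mult_left_mono[OF B(2)[of y], of "\<bar>w y\<bar>"] K(3)
        by (cases "y \<in> cball x r") (auto simp: abs_mult mult.commute)
      then show "AE y in lebesgue. norm (w y *\<^sub>R g (x - y)) \<le> norm (B * (indicator (cball x r) y *\<^sub>R w y))"
        by simp
    qed
  qed
  define I where "I = (\<integral>y. norm (indicator (cball x (r + 1)) y *\<^sub>R w y) \<partial>lebesgue)"
  have I: "0 \<le> I" by (auto simp: I_def)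
  have main: "\<exists>d>0. \<forall>x'. norm (x' - x) < d \<longrightarrow>
      norm (conv k w x' - conv k w x - inner (x' - x) (conv k G x)) \<le> e * norm (x' - x)"
    if e: "0 < e" for e
  proof -
    define e' where "e' = e / (I + 1)"
    have e': "0 < e'" "e' * I \<le> e" using e I by (auto simp: e'_def field_simps)
    from uniformly_continuous_on_UNIV_compact_support[OF g(2,3)] e'(1) obtain d where d: "d > 0"
      "\<And>x y. dist y x < d \<Longrightarrow> dist (g y) (g x) < e'"
      unfolding uniformly_continuous_on_def by auto
    have "norm (conv k w x' - conv k w x - inner (x' - x) (conv k G x)) \<le> e * norm (x' - x)"
      if x': "norm (x' - x) < min d 1" for x'
    proof -
      define h where "h = x' - x"
      define E where "E y = k (x' - y) - k (x - y) - inner h (g (x - y))" for y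
      have "conv k w x' - conv k w x - inner h (conv k G x)
          = (\<integral>y. k (x' - y) *\<^sub>R w y - k (x - y) *\<^sub>R w y - inner h (w y *\<^sub>R g (x - y)) \<partial>lebesgue)"
        unfolding eq integral_inner_right[OF intw, symmetric] unfolding conv_def
        using integrable_inner_right[OF intw, of h] conv_integrable[OF w1 ck k]
        by (simp del: inner_scaleR_right integral_inner_right real_scaleR_def)
      also have "\<dots> = (\<integral>y. E y *\<^sub>R w y \<partial>lebesgue)"
        by (rule Bochner_Integration.integral_cong) (auto simp: E_def algebra_simps)
      also have "norm \<dots> \<le> (norm h * e') * I" unfolding I_def
      proof (rule norm_integral_scaleR_Lloc_1_le[OF w1 _ _ compact_cball])
        show "E \<in> borel_measurable lebesgue"
          unfolding E_def using kernel_translate(1)[OF ck k] kernel_translate(1)[OF g(2,3)]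
          by measurable
        show "\<bar>E y\<bar> \<le> norm h * e'" for y
        proof -
          have "\<bar>k ((x - y) + h) - k (x - y) - inner h (g (x - y))\<bar> \<le> norm h * e'"
          proof (rule GDERIV_linearization_le[OF g(1)])
            fix t :: real assume "t \<in> {0..1}"
            then have "norm (t *\<^sub>R h) \<le> norm h" by (simp add: mult_left_le_one_le)
            then have "dist (x - y + t *\<^sub>R h) (x - y) < d"
              using x' by (simp add: dist_norm h_def)
            then show "norm (g (x - y + t *\<^sub>R h) - g (x - y)) \<le> e'"
              using d(2) by (simp add: dist_norm less_imp_le)
          qed
          then show ?thesis by (simp add: E_def h_def algebra_simps)
        qed
        show "\<forall>y. y \<notin> cball x (r + 1) \<longrightarrow> E y = 0"
        proof (intro allI impI)
          fix y assume y: "y \<notin> cball x (r + 1)"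
          have "dist x y \<le> dist x x' + dist x' y" by (rule dist_triangle)
          then have "y \<notin> cball x' r" "y \<notin> cball x r"
            using x' y by (auto simp: dist_norm norm_minus_commute)
          then show "E y = 0"
            using kernel_translate(3)[OF ck k] kernel_translate(3)[OF g(2,3)] by (simp add: E_def)
        qed
      qed
      also have "\<dots> \<le> e * norm h"
        using mult_left_mono[OF e'(2) norm_ge_zero[of h]] by (simp add: mult_ac)
      finally show ?thesis by (simp add: h_def)
    qed
    then show ?thesis using d(1) by (intro exI[of _ "min d 1"]) auto
  qed
  show ?thesis unfolding gderiv_def has_derivative_at_alt
    using main by (auto intro: bounded_linear_inner_left)
qed

section \<open>Radial cutoff functions and the mollifiers made from them\<close>

definition bump :: "nat \<Rightarrow> real \<Rightarrow> 'a::euclidean_space \<Rightarrow> real" where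
  "bump m r x = max 0 (1 - inner x x / r\<^sup>2) ^ m"

definition bump_grad :: "nat \<Rightarrow> real \<Rightarrow> 'a::euclidean_space \<Rightarrow> 'a" where
  "bump_grad m r x = (- (2 * real m / r\<^sup>2) * max 0 (1 - inner x x / r\<^sup>2) ^ (m - 1)) *\<^sub>R x"

lemma GDERIV_bump:
  assumes "2 \<le> m"
  shows "GDERIV (bump m r) x :> bump_grad m r x"
proof -
  have "GDERIV (\<lambda>x. 1 - inner x x / r\<^sup>2) x :> (- 2 / r\<^sup>2) *\<^sub>R x"
    unfolding gderiv_def
    by (auto intro!: derivative_eq_intros simp: inner_commute divide_inverse)
  from GDERIV_DERIV_compose[OF this DERIV_pos_part_power[OF assms]] show ?thesis
    by (simp add: bump_def[abs_def] bump_grad_def mult_ac)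
qed

lemma continuous_on_bump: "continuous_on UNIV (bump m r)"
  unfolding bump_def[abs_def] divide_inverse by (intro continuous_intros)

lemma continuous_on_bump_grad: "continuous_on UNIV (bump_grad m r)"
  unfolding bump_grad_def[abs_def] divide_inverse by (intro continuous_intros)

lemma bump_nonneg: "0 \<le> bump m r x"
  by (simp add: bump_def)

lemma bump_le_1: "bump m r x \<le> 1"
  by (auto simp: bump_def intro!: power_le_one)

lemma bump_outside:
  assumes "0 < r" "1 \<le> m" "x \<notin> cball 0 r"
  shows "bump m r x = 0"
proof -
  have "r\<^sup>2 \<le> (norm x)\<^sup>2" using assms by (intro power_mono) auto
  then show ?thesis using assms by (simp add: bump_def max_def power2_norm_eq_inner power_0_left field_simps)
qed

lemma bump_grad_outside:
  assumes "0 < r" "2 \<le> m" "x \<notin> cball 0 r"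
  shows "bump_grad m r x = 0"
  using bump_outside[of r "m - 1" x] assms by (simp add: bump_grad_def bump_def)

lemma bump_pos:
  assumes "0 < r" "norm x < r"
  shows "0 < bump m r x"
proof -
  have "(norm x)\<^sup>2 < r\<^sup>2" using assms by (intro power_strict_mono) auto
  then show ?thesis using assms by (simp add: bump_def power2_norm_eq_inner)
qed

lemma bump_integrable:
  assumes "0 < r" "1 \<le> m"
  shows "integrable lebesgue (bump m r :: 'a::euclidean_space \<Rightarrow> real)"
proof -
  have "integrable lebesgue (\<lambda>x::'a. bump m r x *\<^sub>R (1::real))"
  proof (rule integrable_scaleR_Lloc_1[OF _ _ _ compact_cball])
    show "\<bar>bump m r x\<bar> \<le> 1" for x :: 'a using bump_nonneg[of m r x] bump_le_1[of m r x] by simp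
    show "\<forall>x::'a. x \<notin> cball 0 r \<longrightarrow> bump m r x = 0" using bump_outside[OF assms] by blast
  qed (intro continuous_imp_Lloc_1 borel_measurable_lebesgue_continuous continuous_on_bump
      continuous_intros)+
  then show ?thesis by simp
qed

text \<open>Power \<open>2\<close> of the truncated paraboloid is enough: it is already of class
  \<open>C^1\<close>, and test functions need no more.\<close>

definition mollifier :: "real \<Rightarrow> 'a::euclidean_space \<Rightarrow> real" where
  "mollifier r x = bump 2 r x / (\<integral>y. bump 2 r (y::'a) \<partial>lebesgue)"

lemma integral_bump_pos:
  assumes "0 < r" "1 \<le> m"
  shows "0 < (\<integral>y. bump m r (y::'a::euclidean_space) \<partial>lebesgue)"
proof (rule ccontr)
  assume "\<not> ?thesis"
  then have "(\<integral>y. bump m r (y::'a) \<partial>lebesgue) = 0"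
    using Bochner_Integration.integral_nonneg[of lebesgue "bump m r :: 'a \<Rightarrow> real"] bump_nonneg
    by (metis order_less_le)
  then have "AE y in lebesgue. bump m r (y::'a) = 0"
    using integral_nonneg_eq_0_iff_AE[OF bump_integrable[OF assms]] bump_nonneg by auto
  then have "AE y in lebesgue. y \<notin> ball (0::'a) r"
    by (rule AE_mp) (use bump_pos[OF assms(1), of _ m, where 'a = 'a] in \<open>force intro!: AE_I2\<close>)
  then have "ball (0::'a) r \<in> null_sets lebesgue"
    by (subst (asm) AE_iff_null_sets[symmetric]) auto
  then have "negligible (ball (0::'a) r)" by (simp add: negligible_iff_null_sets)
  then show False using open_not_negligible[of "ball (0::'a) r"] assms by auto
qed

context
  fixes r :: real assumes r: "0 < r"
begin

lemma mollifier_nonneg: "0 \<le> mollifier r x"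
  unfolding mollifier_def using bump_nonneg integral_bump_pos[OF r, of 2]
  by (intro divide_nonneg_pos) auto

lemma mollifier_continuous: "continuous_on UNIV (mollifier r)"
  unfolding mollifier_def[abs_def] divide_inverse
  by (intro continuous_intros continuous_on_bump)

lemma mollifier_outside: "\<forall>x. x \<notin> cball 0 r \<longrightarrow> mollifier r x = 0"
  by (simp add: mollifier_def bump_outside[OF r])

lemma GDERIV_mollifier:
  "GDERIV (mollifier r) x :> (1 / (\<integral>y. bump 2 r (y::'a) \<partial>lebesgue)) *\<^sub>R bump_grad 2 r x"
  for x :: "'a::euclidean_space"
  using GDERIV_DERIV_compose[OF GDERIV_bump[of 2 r x] DERIV_cdivide[OF DERIV_ident]]
  by (simp add: mollifier_def[abs_def])

lemma mollifier_minus: "mollifier r (x - y) = mollifier r (y - x)"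
  by (simp add: mollifier_def bump_def inner_commute algebra_simps)

lemma mollifier_integrable: "integrable lebesgue (mollifier r :: 'a::euclidean_space \<Rightarrow> real)"
  unfolding mollifier_def[abs_def] using bump_integrable[OF r, of 2] by auto

lemma integral_mollifier: "(\<integral>x. mollifier r (x::'a::euclidean_space) \<partial>lebesgue) = 1"
  unfolding mollifier_def[abs_def] using integral_bump_pos[OF r, of 2, where 'a = 'a] by simp

lemma
  fixes x :: "'a::euclidean_space"
  shows mollifier_translate_integrable: "integrable lebesgue (\<lambda>y. mollifier r (y - x))"
    and integral_mollifier_translate: "(\<integral>y. mollifier r (y - x) \<partial>lebesgue) = 1"
proof -
  have [measurable]: "mollifier r \<in> borel_measurable (borel :: 'a measure)"
    by (intro borel_measurable_continuous_onI mollifier_continuous)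
  have "integrable (distr lborel borel ((+) (- x))) (mollifier r :: 'a \<Rightarrow> real)"
    using mollifier_integrable[where 'a = 'a] by (simp add: lborel_distr_plus integrable_completion)
  then show "integrable lebesgue (\<lambda>y. mollifier r (y - x))"
    by (simp add: integrable_completion integrable_distr_eq)
  have "(\<integral>y. mollifier r y \<partial>(distr lborel borel ((+) (- x)))) = 1"
    unfolding lborel_distr_plus using integral_mollifier[where 'a = 'a]
    by (simp add: integral_completion)
  then show "(\<integral>y. mollifier r (y - x) \<partial>lebesgue) = 1"
    by (simp add: integral_completion integral_distr)
qed

text \<open>The convolution contracts the \<open>L^1\<close> norm, by Tonelli and the unit mass of
  the mollifier. Extended nonnegative integrals avoid having to know beforehand that
  \<open>conv (mollifier r) f\<close> is integrable.\<close>

lemma nn_integral_norm_conv_mollifier_le: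
  fixes f :: "'a::euclidean_space \<Rightarrow> 'b::euclidean_space"
  assumes f: "f \<in> Lloc 1"
  shows "(\<integral>\<^sup>+x. norm (conv (mollifier r) f x) \<partial>lebesgue) \<le> (\<integral>\<^sup>+x. norm (f x) \<partial>lebesgue)"
proof -
  have [measurable]: "f \<in> borel_measurable lebesgue" using f by (simp add: Lloc_1_iff)
  have mb[measurable]: "mollifier r \<in> borel_measurable (borel :: 'a measure)"
    by (intro borel_measurable_continuous_onI mollifier_continuous)
  have [measurable]: "(\<lambda>x. x) \<in> lebesgue \<rightarrow>\<^sub>M (borel :: 'a measure)"
    by (simp add: measurable_completion)
  have *: "norm (conv (mollifier r) f x) \<le> (\<integral>\<^sup>+y. mollifier r (x - y) * norm (f y) \<partial>lebesgue)" for x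
  proof -
    note int = conv_integrable[OF f mollifier_continuous mollifier_outside, of x]
    have "norm (conv (mollifier r) f x) \<le> (\<integral>y. norm (mollifier r (x - y) *\<^sub>R f y) \<partial>lebesgue)"
      unfolding conv_def by (rule integral_norm_bound)
    then have "ennreal (norm (conv (mollifier r) f x))
        \<le> ennreal (\<integral>y. norm (mollifier r (x - y) *\<^sub>R f y) \<partial>lebesgue)" by (rule ennreal_leI)
    also have "\<dots> = (\<integral>\<^sup>+y. norm (mollifier r (x - y) *\<^sub>R f y) \<partial>lebesgue)"
      by (rule nn_integral_eq_integral[symmetric]) (use integrable_norm[OF int] in auto)
    finally show ?thesis by (simp add: mollifier_nonneg)
  qed
  have "(\<integral>\<^sup>+x. norm (conv (mollifier r) f x) \<partial>lebesgue)
      \<le> (\<integral>\<^sup>+x. \<integral>\<^sup>+y. mollifier r (x - y) * norm (f y) \<partial>lebesgue \<partial>lebesgue)"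
    by (intro nn_integral_mono *)
  also have "\<dots> = (\<integral>\<^sup>+y. \<integral>\<^sup>+x. mollifier r (x - y) * norm (f y) \<partial>lebesgue \<partial>lebesgue)"
    by (rule lebesgue_pair.Fubini'[symmetric]) measurable
  also have "\<dots> = (\<integral>\<^sup>+y. norm (f y) \<partial>lebesgue)"
  proof (rule nn_integral_cong)
    fix y :: 'a
    have "(\<integral>\<^sup>+x. mollifier r (x - y) * norm (f y) \<partial>lebesgue)
        = (\<integral>\<^sup>+x. ennreal (mollifier r (x - y)) * ennreal (norm (f y)) \<partial>lebesgue)"
      by (simp add: ennreal_mult mollifier_nonneg)
    also have "\<dots> = (\<integral>\<^sup>+x. mollifier r (x - y) \<partial>lebesgue) * norm (f y)"
      by (rule nn_integral_multc) measurable
    also have "(\<integral>\<^sup>+x. mollifier r (x - y) \<partial>lebesgue) = 1"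
      by (subst nn_integral_eq_integral[OF mollifier_translate_integrable])
         (auto simp: mollifier_nonneg integral_mollifier_translate)
    finally show "(\<integral>\<^sup>+x. mollifier r (x - y) * norm (f y) \<partial>lebesgue) = norm (f y)" by simp
  qed
  finally show ?thesis .
qed

text \<open>Jensen's inequality for the probability density \<open>mollifier r (x - y)\<close>. It
  bounds powers of mollified gradients by functions that converge in local
  \<open>L^1\<close>.\<close>

lemma norm_conv_mollifier_powr_le:
  fixes f :: "'a::euclidean_space \<Rightarrow> 'b::euclidean_space"
  assumes p: "1 < p" and f: "f \<in> Lloc 1" "f \<in> Lloc p"
  shows "norm (conv (mollifier r) f x) powr p \<le> conv (mollifier r) (\<lambda>y. norm (f y) powr p) x"
proof -
  note fp = Lloc_imp_Lloc_1[OF f(2)]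
  have nf: "(\<lambda>y. norm (f y)) \<in> Lloc 1" using Lloc_imp_Lloc_1[OF f(1)] by simp
  note int = conv_integrable[OF _ mollifier_continuous mollifier_outside, of _ x]
  have m: "integrable lebesgue (\<lambda>y. mollifier r (x - y))" "(\<integral>y. mollifier r (x - y) \<partial>lebesgue) = 1"
    using mollifier_translate_integrable[of x] integral_mollifier_translate[of x]
    by (auto simp: mollifier_minus[of x])
  define a where "a = conv (mollifier r) (\<lambda>y. norm (f y)) x"
  have "norm (conv (mollifier r) f x) \<le> a"
    unfolding a_def conv_def using integral_norm_bound[of lebesgue "\<lambda>y. mollifier r (x - y) *\<^sub>R f y"]
    by (simp add: mollifier_nonneg)
  moreover have "a powr p \<le> conv (mollifier r) (\<lambda>y. norm (f y) powr p) x"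
  proof (cases "a > 0")
    case True
    \<comment> \<open>Integral of the tangent line at \<open>a\<close>: the linear part contributes
      nothing because \<open>a\<close> is the mean of \<open>norm (f y)\<close>. The tangent is
      taken only at positive \<open>a\<close>, hence the case distinction.\<close>
    have "a powr p = (\<integral>y. (a powr p - p * a powr (p - 1) * a) * mollifier r (x - y)
        + (p * a powr (p - 1)) * (mollifier r (x - y) *\<^sub>R norm (f y)) \<partial>lebesgue)"
      using m int[OF nf] by (simp add: a_def conv_def)
    also have "\<dots> \<le> conv (mollifier r) (\<lambda>y. norm (f y) powr p) x"
      unfolding conv_def
    proof (rule integral_mono)
      fix y
      have "mollifier r (x - y) * (a powr p + p * a powr (p - 1) * (norm (f y) - a))
          \<le> mollifier r (x - y) * norm (f y) powr p"
        using True p by (intro mult_left_mono powr_above_tangent) (auto simp: mollifier_nonneg)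
      then show "(a powr p - p * a powr (p - 1) * a) * mollifier r (x - y)
        + (p * a powr (p - 1)) * (mollifier r (x - y) *\<^sub>R norm (f y)) \<le> mollifier r (x - y) *\<^sub>R (norm (f y) powr p)"
        by (simp add: algebra_simps)
    qed (use m int[OF nf] int[OF fp] in auto)
    finally show ?thesis .
  next
    case False
    moreover have "0 \<le> a" unfolding a_def conv_def by (intro Bochner_Integration.integral_nonneg) (simp add: mollifier_nonneg)
    moreover have "0 \<le> conv (mollifier r) (\<lambda>y. norm (f y) powr p) x"
      unfolding conv_def by (intro Bochner_Integration.integral_nonneg) (simp add: mollifier_nonneg)
    ultimately show ?thesis by simp
  qed
  ultimately show ?thesis using p powr_mono2[of p "norm (conv (mollifier r) f x)" a] by simp
qed

end

section \<open>Local \<open>L^1\<close> convergence of mollifications\<close>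

lemma L1_approx_continuous_on_compact:
  fixes f :: "'a::euclidean_space \<Rightarrow> 'b::euclidean_space"
  assumes f: "f \<in> Lloc 1" and K: "compact K" and e: "0 < e"
  shows "\<exists>g. continuous_on UNIV g \<and> (\<integral>x. norm (indicator K x *\<^sub>R (f x - g x)) \<partial>lebesgue) < e"
proof -
  have fm[measurable]: "f \<in> borel_measurable lebesgue" and Km[measurable]: "K \<in> sets lebesgue"
    and fi: "integrable lebesgue (\<lambda>x. indicator K x *\<^sub>R f x)"
    using f K by (auto simp: Lloc_1_iff set_integrable_def compact_imp_closed)
  \<comment> \<open>Truncation to the ball of radius \<open>M\<close> by nearest point projection:
    it is continuous, so it preserves continuity of the approximants, and it does not increase
    norms.\<close>
  define P :: "nat \<Rightarrow> 'b \<Rightarrow> 'b" where "P M = closest_point (cball 0 (real M))" for M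
  have P: "continuous_on UNIV (P M)" "norm (P M z) \<le> real M" "norm z \<le> real M \<Longrightarrow> P M z = z"
      "norm (P M z) \<le> norm z" for M z
  proof -
    show c: "continuous_on UNIV (P M)" unfolding P_def
      by (intro continuous_on_closest_point) auto
    show "norm (P M z) \<le> real M"
      using closest_point_in_set[of "cball (0::'b) (real M)" z] by (auto simp: P_def)
    show "norm z \<le> real M \<Longrightarrow> P M z = z"
      unfolding P_def by (rule closest_point_self) simp
    have "dist (P M z) (P M 0) \<le> dist z 0"
      unfolding P_def by (rule closest_point_lipschitz) auto
    moreover have "P M 0 = 0" unfolding P_def by (rule closest_point_self) simp
    ultimately show "norm (P M z) \<le> norm z" by simp
  qed
  have Pm[measurable]: "P M \<in> borel_measurable borel" for M
    by (intro borel_measurable_continuous_onI P)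
  have "(\<lambda>M. \<integral>x. norm (indicator K x *\<^sub>R (f x - P M (f x))) \<partial>lebesgue) \<longlonglongrightarrow> (\<integral>x. 0 \<partial>(lebesgue :: 'a measure))"
  proof (rule integral_dominated_convergence[where w = "\<lambda>x. 2 * norm (indicator K x *\<^sub>R f x)"])
    show "AE x in lebesgue. (\<lambda>M. norm (indicator K x *\<^sub>R (f x - P M (f x)))) \<longlonglongrightarrow> 0"
    proof (intro AE_I2 tendsto_eventually)
      fix x
      obtain M0 :: nat where "norm (f x) \<le> real M0" using real_arch_simple by blast
      then have "P M (f x) = f x" if "M \<ge> M0" for M using that by (intro P(3)) linarith
      then show "\<forall>\<^sub>F M in sequentially. norm (indicator K x *\<^sub>R (f x - P M (f x))) = 0"
        unfolding eventually_sequentially by (intro exI[of _ M0]) auto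
    qed
    show "AE x in lebesgue. norm (norm (indicator K x *\<^sub>R (f x - P M (f x)))) \<le> 2 * norm (indicator K x *\<^sub>R f x)" for M
    proof (intro AE_I2)
      fix x
      have "norm (f x - P M (f x)) \<le> 2 * norm (f x)"
        using norm_triangle_ineq4[of "f x" "P M (f x)"] P(4)[of M "f x"] by linarith
      then show "norm (norm (indicator K x *\<^sub>R (f x - P M (f x)))) \<le> 2 * norm (indicator K x *\<^sub>R f x)"
        by (simp add: indicator_def)
    qed
  qed (use integrable_norm[OF fi] in auto)
  then have "\<forall>\<^sub>F M in sequentially. (\<integral>x. norm (indicator K x *\<^sub>R (f x - P M (f x))) \<partial>lebesgue) < e / 2"
    using e by (intro order_tendstoD) auto
  then obtain M where M: "(\<integral>x. norm (indicator K x *\<^sub>R (f x - P M (f x))) \<partial>lebesgue) < e / 2"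
    by (auto simp: eventually_sequentially)
  \<comment> \<open>Measurability supplies continuous functions converging to \<open>f\<close>
    almost everywhere, with no bound on them; after projection they are bounded by \<open>M\<close>,
    and dominated convergence on \<open>K\<close> applies.\<close>
  have "f measurable_on UNIV"
    using fm by (simp add: measurable_on_iff_borel_measurable)
  then obtain N g where N: "negligible N" and g: "\<And>n. continuous_on UNIV (g n)"
      "\<And>x. x \<notin> N \<Longrightarrow> (\<lambda>n. g n x) \<longlonglongrightarrow> f x"
    unfolding measurable_on_def by auto
  have [measurable]: "g n \<in> borel_measurable lebesgue" for n
    using g by (intro borel_measurable_lebesgue_continuous)
  have Kf: "integrable lebesgue (\<lambda>x. indicator K x *\<^sub>R (2 * real M))"
    using continuous_imp_Lloc_1[of "\<lambda>_::'a. 2 * real M"] K by (auto simp: Lloc_1_iff set_integrable_def)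
  have "(\<lambda>n. \<integral>x. norm (indicator K x *\<^sub>R (P M (f x) - P M (g n x))) \<partial>lebesgue) \<longlonglongrightarrow> (\<integral>x. 0 \<partial>(lebesgue :: 'a measure))"
  proof (rule integral_dominated_convergence[where w = "\<lambda>x. indicator K x *\<^sub>R (2 * real M)"])
    have "AE x in lebesgue. x \<notin> N"
      using N by (simp add: negligible_iff_null_sets AE_not_in)
    then show "AE x in lebesgue. (\<lambda>n. norm (indicator K x *\<^sub>R (P M (f x) - P M (g n x)))) \<longlonglongrightarrow> 0"
    proof (rule AE_mp, intro AE_I2 impI)
      fix x assume "x \<notin> N"
      then have "(\<lambda>n. P M (g n x)) \<longlonglongrightarrow> P M (f x)"
        using P(1) g(2) by (intro continuous_on_tendsto_compose[OF P(1)]) auto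
      then have "(\<lambda>n. norm (indicator K x *\<^sub>R (P M (f x) - P M (g n x)))) \<longlonglongrightarrow>
          norm (indicator K x *\<^sub>R (P M (f x) - P M (f x)))" by (intro tendsto_intros)
      then show "(\<lambda>n. norm (indicator K x *\<^sub>R (P M (f x) - P M (g n x)))) \<longlonglongrightarrow> 0" by simp
    qed
    show "AE x in lebesgue. norm (norm (indicator K x *\<^sub>R (P M (f x) - P M (g n x))))
        \<le> indicator K x *\<^sub>R (2 * real M)" for n
    proof (intro AE_I2)
      fix x
      have "norm (P M (f x) - P M (g n x)) \<le> 2 * real M"
        using norm_triangle_ineq4[of "P M (f x)" "P M (g n x)"] P(2)[of M "f x"] P(2)[of M "g n x"]
        by linarith
      then show "norm (norm (indicator K x *\<^sub>R (P M (f x) - P M (g n x)))) \<le> indicator K x *\<^sub>R (2 * real M)"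
        by (simp add: indicator_def)
    qed
  qed (use Kf in auto)
  then have "\<forall>\<^sub>F n in sequentially. (\<integral>x. norm (indicator K x *\<^sub>R (P M (f x) - P M (g n x))) \<partial>lebesgue) < e / 2"
    using e by (intro order_tendstoD) auto
  then obtain n where n: "(\<integral>x. norm (indicator K x *\<^sub>R (P M (f x) - P M (g n x))) \<partial>lebesgue) < e / 2"
    by (auto simp: eventually_sequentially)
  have c: "continuous_on UNIV (\<lambda>x. P M (g n x))"
    by (rule continuous_on_compose2[OF P(1) g(1)]) auto
  have PfL: "(\<lambda>x. P M (f x)) \<in> Lloc 1"
  proof -
    have "integrable lebesgue (\<lambda>x. indicator L x *\<^sub>R P M (f x))" if "compact L" for L
    proof (rule Bochner_Integration.integrable_bound)
      show "integrable lebesgue (\<lambda>x. indicator L x *\<^sub>R f x)"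
        using f that by (auto simp: Lloc_1_iff set_integrable_def)
      have [measurable]: "L \<in> sets lebesgue" using that by (simp add: compact_imp_closed)
      show "(\<lambda>x. indicator L x *\<^sub>R P M (f x)) \<in> borel_measurable lebesgue" by measurable
      show "AE x in lebesgue. norm (indicator L x *\<^sub>R P M (f x)) \<le> norm (indicator L x *\<^sub>R f x)"
        using P(4)[of M] by (auto simp: indicator_def)
    qed
    then show ?thesis by (simp add: Lloc_1_iff set_integrable_def)
  qed
  have i1: "integrable lebesgue (\<lambda>x. norm (indicator K x *\<^sub>R (f x - P M (f x))))"
    using Lloc_1_diff[OF f PfL] K by (intro integrable_norm) (auto simp: Lloc_1_iff set_integrable_def)
  have i2: "integrable lebesgue (\<lambda>x. norm (indicator K x *\<^sub>R (P M (f x) - P M (g n x))))"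
    using Lloc_1_diff[OF PfL continuous_imp_Lloc_1[OF c]] K by (intro integrable_norm) (auto simp: Lloc_1_iff set_integrable_def)
  have i3: "integrable lebesgue (\<lambda>x. norm (indicator K x *\<^sub>R (f x - P M (g n x))))"
    using Lloc_1_diff[OF f continuous_imp_Lloc_1[OF c]] K by (intro integrable_norm) (auto simp: Lloc_1_iff set_integrable_def)
  have "(\<integral>x. norm (indicator K x *\<^sub>R (f x - P M (g n x))) \<partial>lebesgue)
      \<le> (\<integral>x. norm (indicator K x *\<^sub>R (f x - P M (f x))) + norm (indicator K x *\<^sub>R (P M (f x) - P M (g n x))) \<partial>lebesgue)"
  proof (rule integral_mono[OF i3 Bochner_Integration.integrable_add[OF i1 i2]])
    fix x
    have "indicator K x *\<^sub>R (f x - P M (g n x)) =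
      indicator K x *\<^sub>R (f x - P M (f x)) + indicator K x *\<^sub>R (P M (f x) - P M (g n x))"
      by (simp add: algebra_simps)
    then show "norm (indicator K x *\<^sub>R (f x - P M (g n x)))
      \<le> norm (indicator K x *\<^sub>R (f x - P M (f x))) + norm (indicator K x *\<^sub>R (P M (f x) - P M (g n x)))"
      by (metis norm_triangle_ineq)
  qed
  also have "\<dots> < e" using M n i1 i2 by simp
  finally show ?thesis using c by blast
qed

text \<open>Three error terms, each below \<open>e / 3\<close>: the mollified error
  \<open>E = f - g\<close>, the oscillation of the continuous \<open>g\<close> on the scale
  \<open>r\<close>, and \<open>E\<close> itself. The radius \<open>R + 1\<close> lets every ball of
  radius \<open>r < 1\<close> about a point of \<open>cball 0 R\<close> stay in
  \<open>K\<close>.\<close>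

lemma conv_mollifier_L1_close:
  fixes f :: "'a::euclidean_space \<Rightarrow> 'b::euclidean_space"
  assumes f: "f \<in> Lloc 1" and R: "0 < R" and e: "0 < e"
  shows "\<exists>d>0. \<forall>r. 0 < r \<and> r < d \<longrightarrow>
     (\<integral>x. norm (indicator (cball 0 R) x *\<^sub>R (conv (mollifier r) f x - f x)) \<partial>lebesgue) < e"
proof -
  define K where "K = cball (0::'a) (R + 1)"
  have K: "compact K" "K \<in> sets lebesgue" by (auto simp: K_def)
  obtain g where g: "continuous_on UNIV g"
    "(\<integral>x. norm (indicator K x *\<^sub>R (f x - g x)) \<partial>lebesgue) < e / 3"
    using L1_approx_continuous_on_compact[OF f K(1), of "e / 3"] e by auto
  define V where "V = measure lebesgue (cball (0::'a) R)"
  define e' where "e' = e / (3 * (V + 1))"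
  have "V \<ge> 0" by (simp add: V_def)
  then have e': "0 < e'" "e' * V < e / 3" using e by (auto simp: e'_def field_simps)
  have "uniformly_continuous_on K g"
    using g K by (intro compact_uniformly_continuous) (auto intro: continuous_on_subset)
  with e'(1) obtain d where d: "d > 0"
    "\<And>x y. x \<in> K \<Longrightarrow> y \<in> K \<Longrightarrow> dist y x < d \<Longrightarrow> dist (g y) (g x) < e'"
    unfolding uniformly_continuous_on_def by meson
  \<comment> \<open>Cutting off outside \<open>K\<close> makes the error globally integrable, so
    that the global \<open>L^1\<close> contraction can be applied to it.\<close>
  define E where "E x = indicator K x *\<^sub>R (f x - g x)" for x
  have gL: "g \<in> Lloc 1" using g by (intro continuous_imp_Lloc_1)
  have Ei: "integrable lebesgue E"
    using Lloc_1_diff[OF f gL] K by (auto simp: Lloc_1_iff set_integrable_def E_def[abs_def])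
  have EL: "E \<in> Lloc 1"
    using Ei integrable_mult_indicator[OF _ Ei]
    by (auto simp: Lloc_1_iff set_integrable_def compact_imp_closed)
  have "(\<integral>x. norm (indicator (cball 0 R) x *\<^sub>R (conv (mollifier r) f x - f x)) \<partial>lebesgue) < e"
    if r: "0 < r" "r < min d 1" for r
  proof -
    note mc = mollifier_continuous[OF r(1)] and mo = mollifier_outside[OF r(1)]
      and mn = mollifier_nonneg[OF r(1)]
    have Cm: "conv (mollifier r) E \<in> borel_measurable lebesgue"
      by (intro borel_measurable_lebesgue_continuous continuous_on_conv[OF EL mc mo])
    have "(\<integral>\<^sup>+x. norm (E x) \<partial>lebesgue) = ennreal (\<integral>x. norm (E x) \<partial>lebesgue)"
      using Ei by (intro nn_integral_eq_integral) auto
    then have nn: "(\<integral>\<^sup>+x. norm (conv (mollifier r) E x) \<partial>lebesgue) \<le> ennreal (\<integral>x. norm (E x) \<partial>lebesgue)"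
      using nn_integral_norm_conv_mollifier_le[OF r(1) EL] by simp
    then have Ci: "integrable lebesgue (conv (mollifier r) E)"
      using Cm by (intro integrableI_bounded) (auto simp: le_less_trans)
    then have Cle: "(\<integral>x. norm (conv (mollifier r) E x) \<partial>lebesgue) \<le> (\<integral>x. norm (E x) \<partial>lebesgue)"
      using nn by (subst (asm) nn_integral_eq_integral) auto
    have pt: "norm (indicator (cball 0 R) x *\<^sub>R (conv (mollifier r) f x - f x))
        \<le> norm (conv (mollifier r) E x) + e' * indicator (cball 0 R) x + norm (E x)" for x
    proof (cases "x \<in> cball 0 R")
      case True
      then have xK: "x \<in> K" by (auto simp: K_def)
      have yK: "y \<in> K" if "y \<in> cball x r" for y
        using dist_triangle[of 0 y x] that True r by (auto simp: K_def)
      note i = conv_integrable[OF _ mc mo, of _ x]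
      have mi: "integrable lebesgue (\<lambda>y. mollifier r (x - y))"
        "(\<integral>y. mollifier r (x - y) \<partial>lebesgue) = 1"
        using mollifier_translate_integrable[OF r(1), of x] integral_mollifier_translate[OF r(1), of x]
        by (auto simp: mollifier_minus[OF r(1), of x])
      define J where "J = (\<integral>y. mollifier r (x - y) *\<^sub>R (g y - g x) \<partial>lebesgue)"
      have gi: "integrable lebesgue (\<lambda>y. mollifier r (x - y) *\<^sub>R (g y - g x))"
        using g by (intro i continuous_imp_Lloc_1 continuous_intros)
      \<comment> \<open>On the support of the kernel \<open>y\<close> lies in \<open>K\<close>, so
        \<open>f y = E y + (g y - g x) + g x\<close>; the last summand integrates to
        \<open>g x\<close> by unit mass.\<close>
      have "conv (mollifier r) f x = (\<integral>y. mollifier r (x - y) *\<^sub>R E y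
          + mollifier r (x - y) *\<^sub>R (g y - g x) + mollifier r (x - y) *\<^sub>R g x \<partial>lebesgue)"
        unfolding conv_def
      proof (rule Bochner_Integration.integral_cong[OF refl])
        fix y
        show "mollifier r (x - y) *\<^sub>R f y = mollifier r (x - y) *\<^sub>R E y
          + mollifier r (x - y) *\<^sub>R (g y - g x) + mollifier r (x - y) *\<^sub>R g x"
          using yK[of y] kernel_translate(3)[OF mc mo, of x]
          by (cases "y \<in> cball x r") (auto simp: E_def algebra_simps)
      qed
      also have "\<dots> = conv (mollifier r) E x + J + g x"
        using i[OF EL] gi mi by (simp add: conv_def J_def)
      finally have "conv (mollifier r) f x - f x = conv (mollifier r) E x + J - E x"
        using xK by (simp add: E_def)
      moreover have "norm J \<le> e'"
      proof -
        have "norm J \<le> (\<integral>y. norm (mollifier r (x - y) *\<^sub>R (g y - g x)) \<partial>lebesgue)"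
          unfolding J_def by (rule integral_norm_bound)
        also have "\<dots> \<le> (\<integral>y. mollifier r (x - y) * e' \<partial>lebesgue)"
        proof (rule integral_mono)
          fix y
          show "norm (mollifier r (x - y) *\<^sub>R (g y - g x)) \<le> mollifier r (x - y) * e'"
          proof (cases "y \<in> cball x r")
            case True
            then have "dist y x < d" using r by (simp add: dist_commute)
            with True have "dist (g y) (g x) < e'" using d(2)[OF xK yK] by blast
            then show ?thesis using mn[of "x - y"] by (simp add: dist_norm mult_left_mono)
          next
            case False
            then show ?thesis using kernel_translate(3)[OF mc mo, of x] by simp
          qed
        qed (use integrable_norm[OF gi] mi in auto)
        also have "\<dots> = e'" using mi by simp
        finally show ?thesis .
      qed
      ultimately show ?thesis
        using True norm_triangle_ineq4[of "conv (mollifier r) E x + J" "E x"]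
          norm_triangle_ineq[of "conv (mollifier r) E x" J] by simp
    qed simp
    have fi: "integrable lebesgue (\<lambda>x. norm (indicator (cball 0 R) x *\<^sub>R (conv (mollifier r) f x - f x)))"
      using Lloc_1_diff[OF continuous_imp_Lloc_1[OF continuous_on_conv[OF f mc mo]] f]
      by (intro integrable_norm) (auto simp: Lloc_1_iff set_integrable_def)
    have ind: "integrable lebesgue (indicat_real (cball (0::'a) R))"
      using lmeasurable_cball by (simp add: lmeasurable_iff_integrable)
    have "(\<integral>x. norm (indicator (cball 0 R) x *\<^sub>R (conv (mollifier r) f x - f x)) \<partial>lebesgue)
        \<le> (\<integral>x. norm (conv (mollifier r) E x) + e' * indicator (cball 0 R) x + norm (E x) \<partial>lebesgue)"
    proof (rule integral_mono[OF fi _ pt])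
      show "integrable lebesgue (\<lambda>x. norm (conv (mollifier r) E x) + e' * indicator (cball 0 R) x + norm (E x))"
        using Ci Ei ind by auto
    qed
    also have "\<dots> = (\<integral>x. norm (conv (mollifier r) E x) \<partial>lebesgue) + e' * V + (\<integral>x. norm (E x) \<partial>lebesgue)"
      using Ci Ei ind by (simp add: V_def)
    also have "\<dots> < e" using Cle g(2) e' unfolding E_def by linarith
    finally show ?thesis .
  qed
  then show ?thesis using d(1) by (intro exI[of _ "min d 1"]) auto
qed

lemma conv_mollifier_L1_tendsto:
  fixes f :: "'a::euclidean_space \<Rightarrow> 'b::euclidean_space"
  assumes f: "f \<in> Lloc 1" and R: "0 < R"
    and \<epsilon>: "\<And>n. 0 < \<epsilon> n" "\<epsilon> \<longlonglongrightarrow> 0"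
  shows "(\<lambda>n. \<integral>x. norm (indicator (cball 0 R) x *\<^sub>R (conv (mollifier (\<epsilon> n)) f x - f x)) \<partial>lebesgue) \<longlonglongrightarrow> 0"
proof (rule tendstoI)
  fix e :: real assume "0 < e"
  then obtain d where d: "d > 0" "\<And>r. 0 < r \<Longrightarrow> r < d \<Longrightarrow>
     (\<integral>x. norm (indicator (cball 0 R) x *\<^sub>R (conv (mollifier r) f x - f x)) \<partial>lebesgue) < e"
    using conv_mollifier_L1_close[OF f R] by blast
  have "\<forall>\<^sub>F n in sequentially. \<epsilon> n < d" using \<epsilon>(2) d(1) by (intro order_tendstoD)
  then show "\<forall>\<^sub>F n in sequentially. dist (\<integral>x. norm (indicator (cball 0 R) x *\<^sub>R
     (conv (mollifier (\<epsilon> n)) f x - f x)) \<partial>lebesgue) 0 < e"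
    by eventually_elim (use d(2) \<epsilon>(1) in \<open>auto simp: dist_norm\<close>)
qed

section \<open>The energy inequality\<close>

text \<open>Dominated convergence with moving majorants \<open>F n\<close> that converge in
  \<open>L^1\<close>. The difference \<open>\<bar>f n x - g x\<bar>\<close> is truncated at the
  fixed integrable function \<open>G x + \<bar>g x\<bar>\<close>; the truncated part
  \<open>h\<close> obeys ordinary dominated convergence, and what exceeds it is at most
  \<open>\<bar>F n x - G x\<bar>\<close>.\<close>

lemma integral_tendsto_generalized_dominated:
  fixes f :: "nat \<Rightarrow> 'a \<Rightarrow> real" and F :: "nat \<Rightarrow> 'a \<Rightarrow> real"
  assumes [measurable]: "\<And>n. f n \<in> borel_measurable M" "g \<in> borel_measurable M"
    and lim: "AE x in M. (\<lambda>n. f n x) \<longlonglongrightarrow> g x"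
    and F: "\<And>n. integrable M (F n)" "integrable M G"
    and dom: "\<And>n. AE x in M. \<bar>f n x\<bar> \<le> F n x" "AE x in M. \<bar>g x\<bar> \<le> G x"
    and FG: "(\<lambda>n. \<integral>x. \<bar>F n x - G x\<bar> \<partial>M) \<longlonglongrightarrow> 0"
  shows "\<And>n. integrable M (f n)" "integrable M g"
    "(\<lambda>n. \<integral>x. f n x \<partial>M) \<longlonglongrightarrow> (\<integral>x. g x \<partial>M)"
proof -
  show fi: "integrable M (f n)" for n
    by (rule Bochner_Integration.integrable_bound[OF F(1)[of n]]) (use dom(1)[of n] in auto)
  show gi: "integrable M g"
    by (rule Bochner_Integration.integrable_bound[OF F(2)]) (use dom(2) in auto)
  have GI: "integrable M (\<lambda>x. G x + \<bar>g x\<bar>)" using F(2) gi by auto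
  define h where "h n x = min \<bar>f n x - g x\<bar> (G x + \<bar>g x\<bar>)" for n x
  have [measurable]: "G \<in> borel_measurable M" "\<And>n. F n \<in> borel_measurable M" using F by auto
  have hm[measurable]: "h n \<in> borel_measurable M" for n unfolding h_def by measurable
  have hb: "AE x in M. norm (h n x) \<le> G x + \<bar>g x\<bar>" for n
    using dom(2) by eventually_elim (auto simp: h_def)
  have hi: "integrable M (h n)" for n
    by (rule Bochner_Integration.integrable_bound[OF GI])
       (use hb[of n] in \<open>auto elim!: eventually_mono\<close>)
  have "(\<lambda>n. \<integral>x. h n x \<partial>M) \<longlonglongrightarrow> (\<integral>x. 0 \<partial>M)"
  proof (rule integral_dominated_convergence[OF _ _ GI _ hb])
    show "AE x in M. (\<lambda>n. h n x) \<longlonglongrightarrow> 0"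
      using lim dom(2)
    proof eventually_elim
      case (elim x)
      have "(\<lambda>n. h n x) \<longlonglongrightarrow> min \<bar>g x - g x\<bar> (G x + \<bar>g x\<bar>)"
        unfolding h_def by (intro tendsto_intros elim)
      then show ?case using elim by (simp add: min_def split: if_splits)
    qed
  qed auto
  then have "(\<lambda>n. (\<integral>x. h n x \<partial>M) + (\<integral>x. \<bar>F n x - G x\<bar> \<partial>M)) \<longlonglongrightarrow> 0 + 0"
    using FG by (intro tendsto_add) auto
  moreover have "norm ((\<integral>x. f n x \<partial>M) - (\<integral>x. g x \<partial>M)) \<le> (\<integral>x. h n x \<partial>M) + (\<integral>x. \<bar>F n x - G x\<bar> \<partial>M)" for n
  proof -
    have "norm ((\<integral>x. f n x \<partial>M) - (\<integral>x. g x \<partial>M)) = norm (\<integral>x. f n x - g x \<partial>M)"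
      using fi gi by simp
    also have "\<dots> \<le> (\<integral>x. norm (f n x - g x) \<partial>M)" by (rule integral_norm_bound)
    also have "\<dots> \<le> (\<integral>x. h n x + \<bar>F n x - G x\<bar> \<partial>M)"
    proof (rule integral_mono_AE)
      show "AE x in M. norm (f n x - g x) \<le> h n x + \<bar>F n x - G x\<bar>"
        using dom(1)[of n] dom(2) by eventually_elim (auto simp: h_def)
    qed (use fi gi hi F in auto)
    also have "\<dots> = (\<integral>x. h n x \<partial>M) + (\<integral>x. \<bar>F n x - G x\<bar> \<partial>M)" using hi F by simp
    finally show ?thesis .
  qed
  ultimately have "(\<lambda>n. (\<integral>x. f n x \<partial>M) - (\<integral>x. g x \<partial>M)) \<longlonglongrightarrow> 0"
    by (intro Lim_null_comparison[where f = "\<lambda>n. (\<integral>x. f n x \<partial>M) - (\<integral>x. g x \<partial>M)"]) auto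
  then show "(\<lambda>n. \<integral>x. f n x \<partial>M) \<longlonglongrightarrow> (\<integral>x. g x \<partial>M)" by (simp add: LIM_zero_iff)
qed

lemma integrable_inner_Lloc_1:
  fixes F g :: "'a::euclidean_space \<Rightarrow> 'b::euclidean_space"
  assumes F: "F \<in> Lloc 1" and [measurable]: "g \<in> borel_measurable lebesgue"
    and B: "\<And>x. norm (g x) \<le> B" and S: "compact S" "\<forall>x. x \<notin> S \<longrightarrow> g x = 0"
  shows "integrable lebesgue (\<lambda>x. inner (F x) (g x))"
proof (rule Bochner_Integration.integrable_bound)
  show "integrable lebesgue (\<lambda>x. B *\<^sub>R (indicator S x *\<^sub>R F x))"
    using F S by (intro integrable_scaleR_right) (auto simp: Lloc_1_iff set_integrable_def)
  have [measurable]: "F \<in> borel_measurable lebesgue" using F by (simp add: Lloc_1_iff)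
  show "(\<lambda>x. inner (F x) (g x)) \<in> borel_measurable lebesgue" by measurable
  have "norm (inner (F x) (g x)) \<le> norm (B *\<^sub>R (indicator S x *\<^sub>R F x))" for x
  proof (cases "x \<in> S")
    case True
    have "\<bar>inner (F x) (g x)\<bar> \<le> norm (F x) * norm (g x)" by (rule Cauchy_Schwarz_ineq2)
    also have "\<dots> \<le> norm (F x) * \<bar>B\<bar>" using B[of x] by (intro mult_left_mono) auto
    finally show ?thesis using True by (simp add: mult.commute)
  qed (use S in auto)
  then show "AE x in lebesgue. norm (inner (F x) (g x)) \<le> norm (B *\<^sub>R (indicator S x *\<^sub>R F x))"
    by simp
qed

lemma Lloc_mono_1:
  assumes "1 \<le> s" "f \<in> Lloc s"
  shows "f \<in> Lloc 1"
proof -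
  have fm[measurable]: "f \<in> borel_measurable lebesgue" using assms by (simp add: Lloc_def)
  have "integrable lebesgue (\<lambda>x. indicator K x *\<^sub>R f x)" if K: "compact K" for K
  proof (rule Bochner_Integration.integrable_bound)
    have "set_integrable lebesgue K (\<lambda>_. 1::real)"
      using continuous_imp_Lloc_1[of "\<lambda>_. 1::real"] K by (auto simp: Lloc_1_iff)
    then show "integrable lebesgue (\<lambda>x. indicator K x *\<^sub>R 1 + indicator K x *\<^sub>R (norm (f x) powr s))"
      using assms K unfolding Lloc_def set_integrable_def by (intro Bochner_Integration.integrable_add) auto
    have [measurable]: "K \<in> sets lebesgue" using K by (simp add: compact_imp_closed)
    show "(\<lambda>x. indicator K x *\<^sub>R f x) \<in> borel_measurable lebesgue" by measurable
    have "t \<le> 1 + t powr s" if "0 \<le> t" for t :: real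
    proof (cases "t \<le> 1")
      case False
      then have "t powr 1 \<le> t powr s" using assms by (intro powr_mono) auto
      then show ?thesis using False by simp
    qed (use powr_ge_zero[of t s] in linarith)
    then show "AE x in lebesgue. norm (indicator K x *\<^sub>R f x)
        \<le> norm (indicator K x *\<^sub>R 1 + indicator K x *\<^sub>R (norm (f x) powr s))"
      by (auto simp: indicator_def)
  qed
  then show ?thesis by (simp add: Lloc_1_iff set_integrable_def)
qed

lemma Lloc_diff:
  fixes f g :: "'a::euclidean_space \<Rightarrow> 'b::euclidean_space"
  assumes "0 \<le> s" "f \<in> Lloc s" "g \<in> Lloc s"
  shows "(\<lambda>x. f x - g x) \<in> Lloc s"
proof -
  have [measurable]: "f \<in> borel_measurable lebesgue" "g \<in> borel_measurable lebesgue"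
    using assms by (auto simp: Lloc_def)
  have "integrable lebesgue (\<lambda>x. indicator K x *\<^sub>R (norm (f x - g x) powr s))" if K: "compact K" for K
  proof (rule Bochner_Integration.integrable_bound)
    show "integrable lebesgue (\<lambda>x. 2 powr s * (indicator K x *\<^sub>R (norm (f x) powr s)
        + indicator K x *\<^sub>R (norm (g x) powr s)))"
      using assms K unfolding Lloc_def set_integrable_def
      by (intro integrable_mult_right Bochner_Integration.integrable_add) auto
    have [measurable]: "K \<in> sets lebesgue" using K by (simp add: compact_imp_closed)
    show "(\<lambda>x. indicator K x *\<^sub>R (norm (f x - g x) powr s)) \<in> borel_measurable lebesgue" by measurable
    have "norm (f x - g x) powr s \<le> 2 powr s * (norm (f x) powr s + norm (g x) powr s)" for x
    proof -
      have "norm (f x - g x) \<le> 2 * max (norm (f x)) (norm (g x))"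
        using norm_triangle_ineq4[of "f x" "g x"] by (auto simp: max_def)
      then have "norm (f x - g x) powr s \<le> (2 * max (norm (f x)) (norm (g x))) powr s"
        using assms by (intro powr_mono2) auto
      also have "\<dots> = 2 powr s * max (norm (f x)) (norm (g x)) powr s"
        by (rule powr_mult)
      also have "\<dots> \<le> 2 powr s * (norm (f x) powr s + norm (g x) powr s)"
        by (intro mult_left_mono) (auto simp: max_def)
      finally show ?thesis .
    qed
    then show "AE x in lebesgue. norm (indicator K x *\<^sub>R (norm (f x - g x) powr s))
        \<le> norm (2 powr s * (indicator K x *\<^sub>R (norm (f x) powr s) + indicator K x *\<^sub>R (norm (g x) powr s)))"
      by (auto simp: indicator_def)
  qed
  then show ?thesis by (simp add: Lloc_def set_integrable_def)
qed

text \<open>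
  This consequence of being a weak gradient is all that the energy inequality uses; for constants it
  is immediate, while \<^const>\<open>weak_gradient\<close> would require that the integral of \<open>grad \<phi>\<close> vanishes.
\<close>

definition mollified_gradient :: "('a::euclidean_space \<Rightarrow> real) \<Rightarrow> ('a \<Rightarrow> 'a) \<Rightarrow> bool" where
  "mollified_gradient u G \<longleftrightarrow> u \<in> Lloc 1 \<and> G \<in> Lloc 1 \<and>
     (\<forall>r>0. \<forall>x. GDERIV (conv (mollifier r) u) x :> conv (mollifier r) G x)"

lemma weak_gradient_imp_mollified_gradient:
  fixes u :: "'a::euclidean_space \<Rightarrow> real"
  assumes "weak_gradient u G"
  shows "mollified_gradient u G"
proof -
  have "GDERIV (conv (mollifier r) u) x :> conv (mollifier r) G x" if r: "0 < r" for r x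
  proof (rule GDERIV_conv[OF assms mollifier_outside[OF r] GDERIV_mollifier[OF r]])
    show "continuous_on UNIV (\<lambda>x::'a. (1 / (\<integral>y. bump 2 r (y::'a) \<partial>lebesgue)) *\<^sub>R bump_grad 2 r x)"
      by (intro continuous_intros continuous_on_bump_grad)
    show "\<forall>z::'a. z \<notin> cball 0 r \<longrightarrow> (1 / (\<integral>y. bump 2 r (y::'a) \<partial>lebesgue)) *\<^sub>R bump_grad 2 r z = 0"
      using bump_grad_outside[OF r, of 2] by auto
  qed
  then show ?thesis using assms by (simp add: mollified_gradient_def weak_gradient_def)
qed

lemma mollified_gradient_const:
  "mollified_gradient (\<lambda>_::'a::euclidean_space. c) (\<lambda>_. 0)"
proof -
  have "conv (mollifier r) (\<lambda>_::'a. c) = (\<lambda>_. c)" if r: "0 < r" for r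
  proof
    show "conv (mollifier r) (\<lambda>_::'a. c) x = c" for x
      using mollifier_translate_integrable[OF r, of x] integral_mollifier_translate[OF r, of x]
      by (simp add: conv_def mollifier_minus[OF r, of x])
  qed
  moreover have "conv (mollifier r) (\<lambda>_::'a. 0::'a) x = 0" for r x by (simp add: conv_def)
  ultimately show ?thesis
    by (auto simp: mollified_gradient_def GDERIV_const intro!: continuous_imp_Lloc_1)
qed

lemma mollified_gradient_diff:
  fixes u v :: "'a::euclidean_space \<Rightarrow> real"
  assumes "mollified_gradient u G" "mollified_gradient v H"
  shows "mollified_gradient (\<lambda>x. u x - v x) (\<lambda>x. G x - H x)"
proof -
  have L: "u \<in> Lloc 1" "v \<in> Lloc 1" "G \<in> Lloc 1" "H \<in> Lloc 1"
    using assms by (auto simp: mollified_gradient_def)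
  have "GDERIV (conv (mollifier r) (\<lambda>x. u x - v x)) x :> conv (mollifier r) (\<lambda>x. G x - H x) x"
    if r: "0 < r" for r x
  proof -
    note i = conv_integrable[OF _ mollifier_continuous[OF r] mollifier_outside[OF r]]
    have "conv (mollifier r) (\<lambda>x. u x - v x) = (\<lambda>x. conv (mollifier r) u x - conv (mollifier r) v x)"
      "conv (mollifier r) (\<lambda>x. G x - H x) x = conv (mollifier r) G x - conv (mollifier r) H x"
      unfolding conv_def scaleR_diff_right
      by (intro ext Bochner_Integration.integral_diff i L)+
    then show ?thesis
      using assms r by (auto simp: mollified_gradient_def intro!: GDERIV_diff)
  qed
  then show ?thesis using L by (simp add: mollified_gradient_def Lloc_1_diff)
qed

text \<open>Pointwise limits are needed because \<open>w\<close> enters through the nonlinear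
  functions \<open>T\<close> and \<open>T'\<close>; a subsequence of an \<open>L^1\<close>
  convergent sequence provides them.\<close>

lemma conv_mollifier_AE_subseq:
  fixes f :: "'a::euclidean_space \<Rightarrow> 'b::euclidean_space"
  assumes f: "f \<in> Lloc 1" and R: "0 < R"
    and \<epsilon>: "\<And>n. 0 < \<epsilon> n" "\<epsilon> \<longlonglongrightarrow> 0"
  shows "\<exists>r. strict_mono r \<and> (AE x in lebesgue. x \<in> cball 0 R \<longrightarrow>
    (\<lambda>n. conv (mollifier (\<epsilon> (r n))) f x) \<longlonglongrightarrow> f x)"
proof -
  have i: "integrable lebesgue (\<lambda>x. indicator (cball 0 R) x *\<^sub>R (conv (mollifier (\<epsilon> n)) f x - f x))" for n
    using Lloc_1_diff[OF continuous_imp_Lloc_1[OF continuous_on_conv[OF f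
        mollifier_continuous[OF \<epsilon>(1)] mollifier_outside[OF \<epsilon>(1)]]] f]
    by (auto simp: Lloc_1_iff set_integrable_def)
  obtain r where r: "strict_mono r"
    "AE x in lebesgue. (\<lambda>n. indicator (cball 0 R) x *\<^sub>R (conv (mollifier (\<epsilon> (r n))) f x - f x)) \<longlonglongrightarrow> 0"
    using tendsto_L1_AE_subseq[OF i conv_mollifier_L1_tendsto[OF f R \<epsilon>]] by blast
  from r(2) have "AE x in lebesgue. x \<in> cball 0 R \<longrightarrow> (\<lambda>n. conv (mollifier (\<epsilon> (r n))) f x) \<longlonglongrightarrow> f x"
    by eventually_elim (auto simp: LIM_zero_iff)
  with r(1) show ?thesis by blast
qed

text \<open>Formally this is the hypothesis \<open>sub\<close> for the test function
  \<open>T (w x) * bump m R x\<close>. Only \<open>w\<close> is mollified, not \<open>D\<close> or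
  \<open>b\<close>, so the mollified test function is of class \<open>C^1\<close> and the hypothesis
  applies to it unchanged. The terms with \<open>T\<close> have fixed majorants because
  \<open>T \<le> 1\<close>; the term with \<open>T'\<close> contains the mollified gradient and
  needs moving ones.\<close>

lemma energy_inequality:
  fixes w b :: "'a::euclidean_space \<Rightarrow> real" and D G :: "'a \<Rightarrow> 'a"
  assumes p: "1 < p" and w: "mollified_gradient w G" and G: "G \<in> Lloc p"
    and D: "D \<in> Lloc (p / (p - 1))" and b: "b \<in> Lloc 1"
    and sub: "\<And>\<phi>. \<phi> \<in> C1_0 \<Longrightarrow> (\<And>x. 0 \<le> \<phi> x) \<Longrightarrow>
      (\<integral>x. inner (D x) (grad \<phi> x) \<partial>lebesgue) + (\<integral>x. b x * \<phi> x \<partial>lebesgue) \<le> 0"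
    and T: "\<And>t. (T has_real_derivative T' t) (at t)" "continuous_on UNIV T'"
      "\<And>t. 0 \<le> T t \<and> T t \<le> 1 \<and> 0 \<le> T' t \<and> T' t \<le> C"
    and R: "0 < R" and m: "2 \<le> m"
  defines "f1 \<equiv> \<lambda>x. T' (w x) * bump m R x * inner (D x) (G x)"
    and "f2 \<equiv> \<lambda>x. T (w x) * inner (D x) (bump_grad m R x)"
    and "f3 \<equiv> \<lambda>x. b x * (T (w x) * bump m R x)"
  shows "integrable lebesgue f1" "integrable lebesgue f2" "integrable lebesgue f3"
    "(\<integral>x. f1 x \<partial>lebesgue) + (\<integral>x. f2 x \<partial>lebesgue) + (\<integral>x. f3 x \<partial>lebesgue) \<le> 0"
proof -
  let ?B = "cball (0::'a) R"
  have L: "w \<in> Lloc 1" "G \<in> Lloc 1" using w by (auto simp: mollified_gradient_def)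
  have D1: "D \<in> Lloc 1" using D p by (intro Lloc_mono_1[of "p / (p - 1)"]) (auto simp: field_simps)
  have [measurable]: "w \<in> borel_measurable lebesgue" "G \<in> borel_measurable lebesgue"
    "D \<in> borel_measurable lebesgue" "b \<in> borel_measurable lebesgue"
    using L D1 b by (auto simp: Lloc_1_iff)
  have cT: "continuous_on UNIV T"
    using T(1) by (meson DERIV_isCont continuous_at_imp_continuous_on)
  have [measurable]: "T \<in> borel_measurable borel" "T' \<in> borel_measurable borel"
    using cT T(2) by (auto intro: borel_measurable_continuous_onI)
  have [measurable]: "bump m R \<in> borel_measurable lebesgue"
    "(bump_grad m R :: 'a \<Rightarrow> 'a) \<in> borel_measurable lebesgue"
    by (auto intro!: borel_measurable_lebesgue_continuous continuous_on_bump continuous_on_bump_grad)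
  have bo: "bump m R x = 0" "bump_grad m R x = 0" if "x \<notin> ?B" for x
    using that bump_outside[OF R, of m x] bump_grad_outside[OF R m, of x] m by auto
  obtain Kg where Kg: "Kg \<ge> 0" "\<And>x. norm (bump_grad m R (x::'a)) \<le> Kg"
    using bounded_compact_support[OF continuous_on_bump_grad compact_cball, of 0 R m R] bo by blast
  have C: "0 \<le> C" using T(3)[of 0] by linarith
  define \<epsilon> where "\<epsilon> n = 1 / real (Suc n)" for n
  have \<epsilon>: "0 < \<epsilon> n" "\<epsilon> \<longlonglongrightarrow> 0" for n
    unfolding \<epsilon>_def using LIMSEQ_inverse_real_of_nat by (auto simp: inverse_eq_divide)
  \<comment> \<open>Two successive extractions, first for \<open>w\<close> and then for
    \<open>G\<close> along the first subsequence, give one sequence \<open>\<delta>\<close> that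
    works for both.\<close>
  obtain r1 where r1: "strict_mono r1" "AE x in lebesgue. x \<in> ?B \<longrightarrow>
      (\<lambda>n. conv (mollifier (\<epsilon> (r1 n))) w x) \<longlonglongrightarrow> w x"
    using conv_mollifier_AE_subseq[OF L(1) R \<epsilon>] by blast
  have \<epsilon>1: "0 < (\<epsilon> \<circ> r1) n" "(\<epsilon> \<circ> r1) \<longlonglongrightarrow> 0" for n
    using \<epsilon>(1) LIMSEQ_subseq_LIMSEQ[OF \<epsilon>(2) r1(1)] by auto
  obtain r2 where r2: "strict_mono r2" "AE x in lebesgue. x \<in> ?B \<longrightarrow>
      (\<lambda>n. conv (mollifier ((\<epsilon> \<circ> r1) (r2 n))) G x) \<longlonglongrightarrow> G x"
    using conv_mollifier_AE_subseq[OF L(2) R \<epsilon>1] by blast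
  define \<delta> where "\<delta> n = \<epsilon> (r1 (r2 n))" for n
  have \<delta>: "0 < \<delta> n" "\<delta> \<longlonglongrightarrow> 0" for n
    using \<epsilon>(1) LIMSEQ_subseq_LIMSEQ[OF \<epsilon>1(2) r2(1)] by (auto simp: \<delta>_def[abs_def] o_def)
  define W where "W n = conv (mollifier (\<delta> n)) w" for n
  define H where "H n = conv (mollifier (\<delta> n)) G" for n
  \<comment> \<open>By Jensen, \<open>P n\<close> majorises \<open>norm (H n x) powr p\<close>, and
    it converges in local \<open>L^1\<close> because it is the mollification of a locally integrable
    function.\<close>
  define P where "P n = conv (mollifier (\<delta> n)) (\<lambda>x. norm (G x) powr p)" for n
  have limW: "AE x in lebesgue. x \<in> ?B \<longrightarrow> (\<lambda>n. W n x) \<longlonglongrightarrow> w x"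
    using r1(2)
  proof eventually_elim
    case (elim x)
    then show ?case
      using LIMSEQ_subseq_LIMSEQ[of "\<lambda>n. conv (mollifier (\<epsilon> (r1 n))) w x" "w x" r2] r2(1)
      by (auto simp: W_def \<delta>_def o_def)
  qed
  have limH: "AE x in lebesgue. x \<in> ?B \<longrightarrow> (\<lambda>n. H n x) \<longlonglongrightarrow> G x"
    using r2(2) by (simp add: H_def \<delta>_def)
  note co = continuous_on_conv[OF _ mollifier_continuous[OF \<delta>(1)] mollifier_outside[OF \<delta>(1)]]
  have cW: "continuous_on UNIV (W n)" and cH: "continuous_on UNIV (H n)"
    and cP: "continuous_on UNIV (P n)" for n
    unfolding W_def H_def P_def by (intro co L Lloc_imp_Lloc_1 G)+
  have [measurable]: "W n \<in> borel_measurable lebesgue" "H n \<in> borel_measurable lebesgue" for n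
    by (auto intro: borel_measurable_lebesgue_continuous cW cH)
  have HP: "norm (H n x) powr p \<le> P n x" for n x
    unfolding H_def P_def by (rule norm_conv_mollifier_powr_le[OF \<delta>(1) p L(2) G])
  define g1 where "g1 n x = T' (W n x) * bump m R x * inner (D x) (H n x)" for n x
  define g2 where "g2 n x = T (W n x) * inner (D x) (bump_grad m R x)" for n x
  define g3 where "g3 n x = b x * (T (W n x) * bump m R x)" for n x

  \<comment> \<open>Young's inequality separates the flux, which is fixed, from the gradient. It is
    stated for an arbitrary \<open>y\<close> so that it covers both \<open>H n x\<close> and the
    limit \<open>G x\<close>.\<close>
  have ineq: "\<bar>T' t * bump m R x * inner (D x) y\<bar>
      \<le> C * (indicator ?B x *\<^sub>R (norm (D x) powr (p / (p - 1)) + norm y powr p))" for t x y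
  proof (cases "x \<in> ?B")
    case True
    have "\<bar>inner (D x) y\<bar> \<le> norm (D x) * norm y" by (rule Cauchy_Schwarz_ineq2)
    also have "\<dots> \<le> norm (D x) powr (p / (p - 1)) + norm y powr p"
      using p by (intro mult_le_add_powr) auto
    finally have 1: "\<bar>inner (D x) y\<bar> \<le> norm (D x) powr (p / (p - 1)) + norm y powr p" .
    have "T' t * bump m R x \<le> C * 1"
      using T(3) bump_nonneg bump_le_1 C by (intro mult_mono) auto
    then have "\<bar>T' t * bump m R x\<bar> \<le> C" using T(3)[of t] bump_nonneg[of m R x] by simp
    then show ?thesis
      using 1 True C by (subst abs_mult) (auto intro!: mult_mono)
  qed (use bo C in auto)
  have Di: "integrable lebesgue (\<lambda>x. indicator ?B x *\<^sub>R (norm (D x) powr (p / (p - 1))))"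
    using D by (auto simp: Lloc_def set_integrable_def)
  have Gi: "integrable lebesgue (\<lambda>x. indicator ?B x *\<^sub>R (norm (G x) powr p))"
    using G by (auto simp: Lloc_def set_integrable_def)
  have Pi: "integrable lebesgue (\<lambda>x. indicator ?B x *\<^sub>R P n x)" for n
    using continuous_imp_Lloc_1[OF cP[of n]] by (auto simp: Lloc_1_iff set_integrable_def)
  have c1: "integrable lebesgue (g1 n)" "integrable lebesgue f1"
      "(\<lambda>n. \<integral>x. g1 n x \<partial>lebesgue) \<longlonglongrightarrow> (\<integral>x. f1 x \<partial>lebesgue)" for n
  proof -
    let ?F = "\<lambda>n x. C * (indicator ?B x *\<^sub>R (norm (D x) powr (p / (p - 1)) + P n x))"
    let ?E = "\<lambda>x. C * (indicator ?B x *\<^sub>R (norm (D x) powr (p / (p - 1)) + norm (G x) powr p))"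
    have m1: "g1 n \<in> borel_measurable lebesgue" for n unfolding g1_def by measurable
    have m2: "f1 \<in> borel_measurable lebesgue" unfolding f1_def by measurable
    have l: "AE x in lebesgue. (\<lambda>n. g1 n x) \<longlonglongrightarrow> f1 x"
      using limW limH
    proof eventually_elim
      case (elim x)
      show ?case
      proof (cases "x \<in> ?B")
        case True
        then have "(\<lambda>n. T' (W n x)) \<longlonglongrightarrow> T' (w x)"
          using elim by (intro continuous_on_tendsto_compose[OF T(2)]) auto
        then show ?thesis unfolding g1_def f1_def using elim True by (intro tendsto_intros) auto
      qed (simp add: g1_def f1_def bo)
    qed
    have F: "integrable lebesgue (?F n)" for n
      using Di Pi[of n] by (auto simp: distrib_left)
    have F0: "integrable lebesgue ?E"
      using Di Gi by (auto simp: distrib_left)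
    have d: "AE x in lebesgue. \<bar>g1 n x\<bar> \<le> ?F n x" for n
    proof (intro AE_I2)
      fix x
      have "\<bar>g1 n x\<bar> \<le> C * (indicator ?B x *\<^sub>R (norm (D x) powr (p / (p - 1)) + norm (H n x) powr p))"
        unfolding g1_def by (rule ineq)
      also have "\<dots> \<le> ?F n x" using HP[of n x] C by (intro mult_left_mono) (auto simp: indicator_def)
      finally show "\<bar>g1 n x\<bar> \<le> ?F n x" .
    qed
    have d0: "AE x in lebesgue. \<bar>f1 x\<bar> \<le> ?E x"
      unfolding f1_def using ineq by (intro AE_I2)
    have "(\<lambda>n. C * (\<integral>x. norm (indicator ?B x *\<^sub>R (P n x - norm (G x) powr p)) \<partial>lebesgue)) \<longlonglongrightarrow> C * 0"
      unfolding P_def by (intro tendsto_intros conv_mollifier_L1_tendsto Lloc_imp_Lloc_1 G R \<delta>)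
    moreover have "(\<integral>x. \<bar>?F n x - ?E x\<bar> \<partial>lebesgue)
        = C * (\<integral>x. norm (indicator ?B x *\<^sub>R (P n x - norm (G x) powr p)) \<partial>lebesgue)" for n
    proof -
      have "\<bar>?F n x - ?E x\<bar> = C * norm (indicator ?B x *\<^sub>R (P n x - norm (G x) powr p))" for x
        using C by (auto simp: indicator_def right_diff_distrib[symmetric] abs_mult)
      then show ?thesis by (subst integral_mult_right_zero[symmetric]) presburger
    qed
    ultimately have FF: "(\<lambda>n. \<integral>x. \<bar>?F n x - ?E x\<bar> \<partial>lebesgue) \<longlonglongrightarrow> 0" by simp
    from integral_tendsto_generalized_dominated[OF m1 m2 l F F0 d d0 FF]
    show "integrable lebesgue (g1 n)" "integrable lebesgue f1"
      "(\<lambda>n. \<integral>x. g1 n x \<partial>lebesgue) \<longlonglongrightarrow> (\<integral>x. f1 x \<partial>lebesgue)" for n by blast+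
  qed
  have limT: "AE x in lebesgue. x \<in> ?B \<longrightarrow> (\<lambda>n. T (W n x)) \<longlonglongrightarrow> T (w x)"
    using limW
  proof eventually_elim
    case (elim x)
    then show ?case by (auto intro!: continuous_on_tendsto_compose[OF cT])
  qed
  have Dgi: "integrable lebesgue (\<lambda>x. norm (inner (D x) (bump_grad m R x)))"
    by (intro integrable_norm integrable_inner_Lloc_1[OF D1 _ Kg(2) compact_cball[of 0 R]])
       (use bo in auto)
  have c2: "integrable lebesgue (g2 n)" "integrable lebesgue f2"
      "(\<lambda>n. \<integral>x. g2 n x \<partial>lebesgue) \<longlonglongrightarrow> (\<integral>x. f2 x \<partial>lebesgue)" for n
  proof -
    have m1: "g2 n \<in> borel_measurable lebesgue" for n unfolding g2_def by measurable
    have m2: "f2 \<in> borel_measurable lebesgue" unfolding f2_def by measurable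
    have l: "AE x in lebesgue. (\<lambda>n. g2 n x) \<longlonglongrightarrow> f2 x"
      using limT
    proof eventually_elim
      case (elim x)
      then show ?case
        by (cases "x \<in> ?B") (auto simp: g2_def f2_def bo intro!: tendsto_intros)
    qed
    have d: "AE x in lebesgue. norm (g2 n x) \<le> norm (inner (D x) (bump_grad m R x))" for n
      unfolding g2_def using T(3) by (intro AE_I2) (auto simp: abs_mult intro!: mult_left_le_one_le)
    show "integrable lebesgue (g2 n)" for n
      by (rule integrable_dominated_convergence2[OF m2 m1 Dgi l d])
    show "integrable lebesgue f2"
      by (rule integrable_dominated_convergence[OF m2 m1 Dgi l d])
    show "(\<lambda>n. \<integral>x. g2 n x \<partial>lebesgue) \<longlonglongrightarrow> (\<integral>x. f2 x \<partial>lebesgue)"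
      by (rule integral_dominated_convergence[OF m2 m1 Dgi l d])
  qed
  have bi: "integrable lebesgue (\<lambda>x. norm (indicator ?B x *\<^sub>R b x))"
    using b by (intro integrable_norm) (auto simp: Lloc_1_iff set_integrable_def)
  have c3: "integrable lebesgue (g3 n)" "integrable lebesgue f3"
      "(\<lambda>n. \<integral>x. g3 n x \<partial>lebesgue) \<longlonglongrightarrow> (\<integral>x. f3 x \<partial>lebesgue)" for n
  proof -
    have m1: "g3 n \<in> borel_measurable lebesgue" for n unfolding g3_def by measurable
    have m2: "f3 \<in> borel_measurable lebesgue" unfolding f3_def by measurable
    have l: "AE x in lebesgue. (\<lambda>n. g3 n x) \<longlonglongrightarrow> f3 x"
      using limT
    proof eventually_elim
      case (elim x)
      then show ?case
        by (cases "x \<in> ?B") (auto simp: g3_def f3_def bo intro!: tendsto_intros)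
    qed
    have d: "AE x in lebesgue. norm (g3 n x) \<le> norm (indicator ?B x *\<^sub>R b x)" for n
    proof (intro AE_I2)
      fix x
      have "T (W n x) * bump m R x \<le> 1" "0 \<le> T (W n x) * bump m R x"
        using T(3) bump_nonneg[of m R x] bump_le_1[of m R x] by (auto intro: mult_le_one)
      then have "\<bar>b x\<bar> * \<bar>T (W n x) * bump m R x\<bar> \<le> \<bar>b x\<bar>"
        by (intro mult_left_le) auto
      then show "norm (g3 n x) \<le> norm (indicator ?B x *\<^sub>R b x)"
        by (cases "x \<in> ?B") (auto simp: g3_def abs_mult bo)
    qed
    show "integrable lebesgue (g3 n)" for n
      by (rule integrable_dominated_convergence2[OF m2 m1 bi l d])
    show "integrable lebesgue f3"
      by (rule integrable_dominated_convergence[OF m2 m1 bi l d])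
    show "(\<lambda>n. \<integral>x. g3 n x \<partial>lebesgue) \<longlonglongrightarrow> (\<integral>x. f3 x \<partial>lebesgue)"
      by (rule integral_dominated_convergence[OF m2 m1 bi l d])
  qed
  have le: "(\<integral>x. g1 n x \<partial>lebesgue) + (\<integral>x. g2 n x \<partial>lebesgue) + (\<integral>x. g3 n x \<partial>lebesgue) \<le> 0" for n
  proof -
    \<comment> \<open>Product and chain rule are classical here; the two parts of the gradient
      \<open>?g\<close> produce the integrands \<open>g2\<close> and \<open>g1\<close>.\<close>
    let ?\<phi> = "\<lambda>x. T (W n x) * bump m R x"
    let ?g = "\<lambda>x. T (W n x) *\<^sub>R bump_grad m R x + bump m R x *\<^sub>R (T' (W n x) *\<^sub>R H n x)"
    have der: "GDERIV ?\<phi> x :> ?g x" for x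
      using w \<delta>(1) T(1) unfolding W_def H_def mollified_gradient_def
      by (intro GDERIV_mult GDERIV_DERIV_compose GDERIV_bump m) auto
    have "?\<phi> \<in> C1_0"
    proof (rule C1_0I[OF der _ compact_cball])
      show "continuous_on UNIV ?g"
        by (intro continuous_intros continuous_on_bump continuous_on_bump_grad cH
            continuous_on_compose2[OF cT cW] continuous_on_compose2[OF T(2) cW]) auto
      show "\<forall>x. x \<notin> ?B \<longrightarrow> ?\<phi> x = 0" using bo by auto
    qed
    moreover have "0 \<le> ?\<phi> x" for x using T(3) bump_nonneg by (intro mult_nonneg_nonneg) auto
    ultimately have "(\<integral>x. inner (D x) (grad ?\<phi> x) \<partial>lebesgue) + (\<integral>x. b x * ?\<phi> x \<partial>lebesgue) \<le> 0"
      by (rule sub)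
    moreover have "(\<integral>x. inner (D x) (grad ?\<phi> x) \<partial>lebesgue) = (\<integral>x. g2 n x + g1 n x \<partial>lebesgue)"
      unfolding grad_eqI[OF der] g1_def g2_def
      by (rule Bochner_Integration.integral_cong) (auto simp: inner_add_right mult_ac)
    ultimately show ?thesis using c1(1)[of n] c2(1)[of n] by (simp add: g3_def)
  qed
  show "integrable lebesgue f1" "integrable lebesgue f2" "integrable lebesgue f3" by fact+
  show "(\<integral>x. f1 x \<partial>lebesgue) + (\<integral>x. f2 x \<partial>lebesgue) + (\<integral>x. f3 x \<partial>lebesgue) \<le> 0"
    by (rule LIMSEQ_le_const2[OF tendsto_add[OF tendsto_add[OF c1(3) c2(3)] c3(3)]]) (use le in auto)
qed

section \<open>Comparison\<close>

text \<open>The gradient of \<open>s^m\<close> costs one power of \<open>s\<close>, that is the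
  fraction \<open>1/m\<close> of the exponent. Since \<open>s \<le> 1\<close> and
  \<open>M \<le> m\<close>, this is at most the fraction \<open>1/M\<close>. The factor
  \<open>1/R\<close> arises from \<open>norm x / R^2\<close> on the ball.\<close>

lemma norm_bump_grad_le:
  assumes R: "0 < R" and m: "2 \<le> m" "M \<le> real m" and M: "0 < M"
  shows "norm (bump_grad m R x) \<le> 2 * real m / R * bump m R x powr (1 - 1 / M)"
proof (cases "x \<in> cball 0 R")
  case True
  define s where "s = max 0 (1 - inner x x / R\<^sup>2)"
  have s: "0 \<le> s" "s \<le> 1" by (auto simp: s_def)
  have "s ^ (m - 1) \<le> (s ^ m) powr (1 - 1 / M)"
  proof (cases "s = 0")
    case False
    then have s0: "0 < s" using s by simp
    have "(1 - 1 / M) * m \<le> m - 1" using m M by (simp add: field_simps of_nat_diff)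
    then have "s powr real (m - 1) \<le> s powr (m * (1 - 1 / M))"
      using s s0 m by (intro powr_mono') (auto simp: mult.commute of_nat_diff)
    then show ?thesis using s0 by (simp add: powr_realpow[symmetric] powr_powr)
  \<comment> \<open>At \<open>s = 0\<close> both sides vanish: \<open>0 powr\<close> anything is
    \<open>0\<close>, and \<open>m - 1\<close> is positive.\<close>
  qed (use m in \<open>simp add: power_0_left\<close>)
  then have "s ^ (m - 1) * norm x \<le> (s ^ m) powr (1 - 1 / M) * R"
    using True s by (intro mult_mono) auto
  then have "2 * real m / R\<^sup>2 * (s ^ (m - 1) * norm x) \<le> 2 * real m / R\<^sup>2 * ((s ^ m) powr (1 - 1 / M) * R)"
    by (intro mult_left_mono) auto
  then show ?thesis
    unfolding bump_grad_def bump_def s_def[symmetric]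
    using s R by (simp add: power2_eq_square mult_ac)
qed (use bump_grad_outside[OF R m(1), of x] R in auto)

text \<open>Young's inequality with weights \<open>\<alpha> = (p - 1)/p\<close>,
  \<open>\<theta> = 1/p - 1/M\<close> and \<open>1/M\<close>. The first two factors are the
  absorbing terms raised to \<open>\<alpha>\<close> and \<open>\<theta>\<close>. They use up the
  power \<open>\<alpha> + \<theta> = 1 - 1/M\<close> of \<open>\<psi>\<close>, which is the one
  allowed by the gradient bound, and \<open>T powr \<theta>\<close>; the remaining
  \<open>T powr (\<alpha> + 1/M)\<close> is what the condition on the profile estimates. Only
  constants are left for the third factor.\<close>

lemma young_absorption:
  fixes d g t T T' \<psi> :: real
  assumes p: "1 < p" and M: "p < M" and pos: "0 < c1" "0 < c2" "0 \<le> C" "0 \<le> A"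
    and nn: "0 \<le> d" "0 < t" "0 \<le> T" "0 \<le> T'" "0 \<le> \<psi>"
    and g: "g \<le> A * \<psi> powr (1 - 1 / M)"
    and T: "T powr ((p - 1) / p + 1 / M) \<le> C * t powr (q / p - q / M) * T' powr ((p - 1) / p)"
  shows "d * g * T \<le> c1 * d powr (p / (p - 1)) * T' * \<psi> + c2 * t powr q * T * \<psi>
     + (A * C * c1 powr (- ((p - 1) / p)) * c2 powr (- (1 / p - 1 / M))) powr M"
proof -
  define \<alpha> \<theta> where "\<alpha> = (p - 1) / p" and "\<theta> = 1 / p - 1 / M"
  have \<alpha>: "0 < \<alpha>" "0 < \<theta>" "\<alpha> + \<theta> + 1 / M = 1" "p / (p - 1) * \<alpha> = 1" "1 / \<alpha> = p / (p - 1)"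
    using p M by (auto simp: \<alpha>_def \<theta>_def field_simps)
  define X where "X = (c1 * d powr (p / (p - 1)) * T' * \<psi>) powr \<alpha>"
  define Y where "Y = (c2 * t powr q * T * \<psi>) powr \<theta>"
  define Z where "Z = A * C * c1 powr (- \<alpha>) * c2 powr (- \<theta>)"
  have X: "X = c1 powr \<alpha> * d * T' powr \<alpha> * \<psi> powr \<alpha>"
    unfolding X_def using pos nn \<alpha> by (simp add: powr_mult powr_powr)
  have Y: "Y = c2 powr \<theta> * t powr (q * \<theta>) * T powr \<theta> * \<psi> powr \<theta>"
    unfolding Y_def using pos nn \<alpha> by (simp add: powr_mult powr_powr)
  have q\<theta>: "q / p - q / M = q * \<theta>" by (simp add: \<theta>_def field_simps)
  \<comment> \<open>The exponents add up to \<open>1\<close>; the first power is traded for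
    \<open>t powr (q * \<theta>) * T' powr \<alpha>\<close>, and the second goes into
    \<open>Y\<close>.\<close>
  have "T = T powr (\<alpha> + 1 / M) * T powr \<theta>"
    using nn \<alpha> by (subst powr_add[symmetric]) (simp add: add_ac)
  also have "\<dots> \<le> (C * t powr (q * \<theta>) * T' powr \<alpha>) * T powr \<theta>"
    using T by (intro mult_right_mono) (auto simp: \<alpha>_def q\<theta>)
  finally have Tle: "T \<le> C * t powr (q * \<theta>) * T' powr \<alpha> * T powr \<theta>" .
  have "1 - 1 / M = \<alpha> + \<theta>" using \<alpha> by simp
  then have g': "g \<le> A * (\<psi> powr \<alpha> * \<psi> powr \<theta>)" using g by (simp add: powr_add)
  have "d * g * T \<le> d * (A * (\<psi> powr \<alpha> * \<psi> powr \<theta>)) * T"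
    using g' nn by (intro mult_right_mono mult_left_mono) auto
  also have "\<dots> \<le> d * (A * (\<psi> powr \<alpha> * \<psi> powr \<theta>)) * (C * t powr (q * \<theta>) * T' powr \<alpha> * T powr \<theta>)"
    using Tle nn pos by (intro mult_left_mono) auto
  also have "\<dots> = X * Y * Z"
  proof -
    have "c1 powr \<alpha> * c1 powr (- \<alpha>) = 1" "c2 powr \<theta> * c2 powr (- \<theta>) = 1"
      using pos by (auto simp: powr_add[symmetric])
    moreover have "X * Y * Z = (c1 powr \<alpha> * c1 powr (- \<alpha>)) * (c2 powr \<theta> * c2 powr (- \<theta>)) *
      (d * (A * (\<psi> powr \<alpha> * \<psi> powr \<theta>)) * (C * t powr (q * \<theta>) * T' powr \<alpha> * T powr \<theta>))"
      unfolding X Y Z_def by (simp only: mult_ac)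
    ultimately show ?thesis by simp
  qed
  also have "\<dots> \<le> X powr (1 / \<alpha>) + Y powr (1 / \<theta>) + Z powr (1 / (1 / M))"
    using \<alpha> p M pos by (intro mult3_le_add_powr) (auto simp: X_def Y_def Z_def)
  also have "\<dots> = c1 * d powr (p / (p - 1)) * T' * \<psi> + c2 * t powr q * T * \<psi> + Z powr M"
    unfolding X_def Y_def using \<alpha>(1,2) pos nn by (simp add: powr_powr)
  finally show ?thesis unfolding Z_def \<alpha>_def \<theta>_def .
qed

text \<open>After absorption, the integral of \<open>b T(w)\<close> against the cutoff is at most a
  constant times \<open>R^(N - M)\<close>, where \<open>N\<close> is the dimension. It tends to
  \<open>0\<close>, although the integrand is nonnegative and positive wherever \<open>w > 0\<close>
  inside the ball.\<close>

lemma AE_nonpos_of_differential_inequality: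
  fixes w b :: "'a::euclidean_space \<Rightarrow> real" and D G :: "'a \<Rightarrow> 'a"
  assumes p: "1 < p" and q: "p - 1 < q" and w: "mollified_gradient w G" and G: "G \<in> Lloc p"
    and D: "D \<in> Lloc (p / (p - 1))" and b: "b \<in> Lloc 1"
    and sub: "\<And>\<phi>. \<phi> \<in> C1_0 \<Longrightarrow> (\<And>x. 0 \<le> \<phi> x) \<Longrightarrow>
      (\<integral>x. inner (D x) (grad \<phi> x) \<partial>lebesgue) + (\<integral>x. b x * \<phi> x \<partial>lebesgue) \<le> 0"
    and c: "0 < c1" "0 < c2"
    and DG: "\<And>x. c1 * norm (D x) powr (p / (p - 1)) \<le> inner (D x) (G x)"
    and bw: "\<And>x. 0 < w x \<Longrightarrow> c2 * w x powr q \<le> b x"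
  shows "AE x in lebesgue. w x \<le> 0"
proof -
  let ?N = "real DIM('a)"
  \<comment> \<open>The three lower bounds serve, in turn, the limit of
    \<open>R powr (?N - M)\<close>, the positivity of the weight \<open>1/p - 1/M\<close>, and the
    existence of the profile; the last one is finite because \<open>q > p - 1\<close>.\<close>
  define M where "M = max ?N (max p (q * p / (q - p + 1))) + 1"
  have M: "?N < M" "p < M" "q * p / (q - p + 1) < M" by (auto simp: M_def)
  have M0: "0 < M" using M p by linarith
  have pq: "(p - 1) / p < q / p - q / M"
  proof -
    have "q / M < (q - p + 1) / p" using M(3) q p M0 by (simp add: field_simps)
    also have "\<dots> = q / p - (p - 1) / p" using p by (simp add: field_simps)
    finally show ?thesis by simp
  qed
  obtain T T' C where T: "\<And>t. (T has_real_derivative T' t) (at t)" "continuous_on UNIV T'"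
      "\<And>t. 0 \<le> T t \<and> T t \<le> 1 \<and> 0 \<le> T' t \<and> T' t \<le> C"
    and Tpos: "\<And>t. 0 < t \<Longrightarrow> 0 < T t" and Tneg: "\<And>t. t \<le> 0 \<Longrightarrow> T t = 0 \<and> T' t = 0" and C: "0 < C"
    and TT: "\<And>t. 0 < t \<Longrightarrow> T t powr ((p - 1) / p + 1 / M) \<le> C * t powr (q / p - q / M) * T' t powr ((p - 1) / p)"
    using exists_test_profile[OF p M0 pq] by metis
  define m where "m = nat \<lceil>M\<rceil> + 2"
  have m: "2 \<le> m" "M \<le> real m" unfolding m_def by (auto, linarith)
  define H where "H x = b x * T (w x)" for x
  have H0: "0 \<le> H x" for x
  proof (cases "0 < w x")
    case True
    have "0 \<le> c2 * w x powr q" using c by simp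
    then have "0 \<le> b x" using bw[OF True] by linarith
    then show ?thesis using T(3) by (simp add: H_def)
  qed (use Tneg in \<open>auto simp: H_def\<close>)
  \<comment> \<open>The constant of \<open>young_absorption\<close> without its factor
    \<open>1/R\<close>. It uses \<open>c2 / 2\<close> so that half of the zero order term survives
    the absorption.\<close>
  define K where "K = (2 * real m * C * c1 powr (- ((p - 1) / p)) * (c2 / 2) powr (- (1 / p - 1 / M))) powr M"
  have K: "0 \<le> K" by (simp add: K_def)
  have main: "(\<integral>x. H x * bump m R x \<partial>lebesgue) \<le> 2 * K * unit_ball_vol ?N * R powr (?N - M)"
    and Hi: "integrable lebesgue (\<lambda>x. H x * bump m R x)" if R: "0 < R" for R
  proof -
    note E = energy_inequality[OF p w G D b sub T R m(1)]
    let ?f1 = "\<lambda>x. T' (w x) * bump m R x * inner (D x) (G x)"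
    let ?f2 = "\<lambda>x. T (w x) * inner (D x) (bump_grad m R x)"
    let ?f3 = "\<lambda>x. b x * (T (w x) * bump m R x)"
    have E: "integrable lebesgue ?f1" "integrable lebesgue ?f2" "integrable lebesgue ?f3"
      "(\<integral>x. ?f1 x \<partial>lebesgue) + (\<integral>x. ?f2 x \<partial>lebesgue) + (\<integral>x. ?f3 x \<partial>lebesgue) \<le> 0"
      by (rule E; assumption)+
    have f3: "?f3 = (\<lambda>x. H x * bump m R x)" by (auto simp: H_def)
    show Hi: "integrable lebesgue (\<lambda>x. H x * bump m R x)" using E(3) unfolding f3 .
    \<comment> \<open>Where \<open>w \<le> 0\<close> both \<open>T\<close> and \<open>T'\<close>
      vanish, and off the ball the cutoff does. Elsewhere \<open>?f1\<close> and half of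
      \<open>?f3\<close> absorb the negative part of \<open>?f2\<close> up to the constant, and the
      other half of \<open>?f3\<close> is the left hand side.\<close>
    have pt: "1/2 * (H x * bump m R x) \<le> ?f1 x + ?f2 x + ?f3 x + K * R powr (- M) * indicator (cball 0 R) x" for x
    proof (cases "0 < w x")
      case False
      then show ?thesis using Tneg[of "w x"] K by (simp add: H_def)
    next
      case True
      show ?thesis
      proof (cases "x \<in> cball 0 R")
        case False
        then show ?thesis using bump_outside[OF R, of m x] bump_grad_outside[OF R m(1), of x] m by simp
      next
        case xB: True
        have "norm (D x) * norm (bump_grad m R x) * T (w x)
          \<le> c1 * norm (D x) powr (p / (p - 1)) * T' (w x) * bump m R x
            + (c2 / 2) * w x powr q * T (w x) * bump m R x
            + (2 * real m / R * C * c1 powr (- ((p - 1) / p)) * (c2 / 2) powr (- (1 / p - 1 / M))) powr M"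
          using c C R T(3) True bump_nonneg[of m R x] m
          by (intro young_absorption[OF p M(2)] norm_bump_grad_le M0 TT) auto
        also have "2 * real m / R * C * c1 powr (- ((p - 1) / p)) * (c2 / 2) powr (- (1 / p - 1 / M))
          = (2 * real m * C * c1 powr (- ((p - 1) / p)) * (c2 / 2) powr (- (1 / p - 1 / M))) * (1 / R)"
          by simp
        also have "\<dots> powr M = K * (1 / R) powr M"
          unfolding K_def by (rule powr_mult)
        also have "(1 / R) powr M = R powr (- M)" using R by (simp add: powr_divide powr_minus_divide)
        finally have 1: "norm (D x) * norm (bump_grad m R x) * T (w x)
          \<le> c1 * norm (D x) powr (p / (p - 1)) * T' (w x) * bump m R x
            + (c2 / 2) * w x powr q * T (w x) * bump m R x + K * R powr (- M)" .
        have 2: "c1 * norm (D x) powr (p / (p - 1)) * (T' (w x) * bump m R x) \<le> inner (D x) (G x) * (T' (w x) * bump m R x)"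
          using T(3) bump_nonneg[of m R x] by (intro mult_right_mono DG) auto
        have 3: "c2 * w x powr q * (T (w x) * bump m R x) \<le> b x * (T (w x) * bump m R x)"
          using T(3) bump_nonneg[of m R x] by (intro mult_right_mono bw True) auto
        have "\<bar>inner (D x) (bump_grad m R x)\<bar> \<le> norm (D x) * norm (bump_grad m R x)"
          by (rule Cauchy_Schwarz_ineq2)
        then have "- inner (D x) (bump_grad m R x) * T (w x) \<le> norm (D x) * norm (bump_grad m R x) * T (w x)"
          using T(3) by (intro mult_right_mono) auto
        then show ?thesis using 1 2 3 xB by (simp add: H_def mult_ac)
      qed
    qed
    have ind: "integrable lebesgue (indicat_real (cball (0::'a) R))"
      using lmeasurable_cball by (simp add: lmeasurable_iff_integrable)
    have "1/2 * (\<integral>x. H x * bump m R x \<partial>lebesgue) = (\<integral>x. 1/2 * (H x * bump m R x) \<partial>lebesgue)"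
      by simp
    also have "\<dots> \<le> (\<integral>x. ?f1 x + ?f2 x + ?f3 x + K * R powr (- M) * indicator (cball 0 R) x \<partial>lebesgue)"
    proof (rule integral_mono[OF _ _ pt])
      show "integrable lebesgue (\<lambda>x. 1/2 * (H x * bump m R x))"
        using Hi by (intro integrable_mult_right)
      show "integrable lebesgue (\<lambda>x. ?f1 x + ?f2 x + ?f3 x + K * R powr (- M) * indicator (cball 0 R) x)"
        using E ind by (intro Bochner_Integration.integrable_add integrable_mult_right) auto
    qed
    also have "\<dots> = (\<integral>x. ?f1 x \<partial>lebesgue) + (\<integral>x. ?f2 x \<partial>lebesgue) + (\<integral>x. ?f3 x \<partial>lebesgue)
        + K * R powr (- M) * measure lebesgue (cball (0::'a) R)"
      using E(1-3) ind by simp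
    also have "\<dots> \<le> K * R powr (- M) * measure lebesgue (cball (0::'a) R)" using E(4) by simp
    also have "measure lebesgue (cball (0::'a) R) = unit_ball_vol ?N * R powr ?N"
      using R content_cball[of R "0::'a"] by (simp add: powr_realpow)
    finally show "(\<integral>x. H x * bump m R x \<partial>lebesgue) \<le> 2 * K * unit_ball_vol ?N * R powr (?N - M)"
      using R by (simp add: powr_diff powr_minus field_simps)
  qed
  have "AE x in lebesgue. x \<in> ball 0 R0 \<longrightarrow> w x \<le> 0" if R0: "0 < R0" for R0
  proof -
    have zero: "(\<integral>x. H x * bump m R0 x \<partial>lebesgue) \<le> 0"
    \<comment> \<open>The integral for the fixed radius \<open>R0\<close> is bounded by the one for
      any larger \<open>R\<close>, because \<open>bump m R\<close> increases with \<open>R\<close>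
      and \<open>H\<close> is nonnegative; then \<open>R\<close> tends to infinity.\<close>
    proof (rule tendsto_lowerbound)
      have "((\<lambda>R. R powr (?N - M)) \<longlongrightarrow> 0) at_top"
        using M(1) by (intro tendsto_neg_powr) (auto simp: filterlim_ident)
      then have "((\<lambda>R. 2 * K * unit_ball_vol ?N * R powr (?N - M)) \<longlongrightarrow> 2 * K * unit_ball_vol ?N * 0) at_top"
        by (intro tendsto_intros)
      then show "((\<lambda>R. 2 * K * unit_ball_vol ?N * R powr (?N - M)) \<longlongrightarrow> 0) at_top" by simp
      show "\<forall>\<^sub>F R in at_top. (\<integral>x. H x * bump m R0 x \<partial>lebesgue) \<le> 2 * K * unit_ball_vol ?N * R powr (?N - M)"
        using eventually_ge_at_top[of R0]
      proof eventually_elim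
        case (elim R)
        have "(\<integral>x. H x * bump m R0 x \<partial>lebesgue) \<le> (\<integral>x. H x * bump m R x \<partial>lebesgue)"
        proof (intro integral_mono Hi mult_left_mono H0)
          fix x :: 'a
          have "inner x x / R\<^sup>2 \<le> inner x x / R0\<^sup>2"
            using elim R0 by (intro divide_left_mono power_mono) auto
          then show "bump m R0 x \<le> bump m R x"
            unfolding bump_def by (intro power_mono) auto
        qed (use elim R0 in auto)
        also have "\<dots> \<le> 2 * K * unit_ball_vol ?N * R powr (?N - M)"
          using elim R0 by (intro main) auto
        finally show ?case .
      qed
    qed simp
    have nn: "AE x in lebesgue. 0 \<le> H x * bump m R0 x"
      using H0 bump_nonneg by (intro AE_I2 mult_nonneg_nonneg) auto
    then have "(\<integral>x. H x * bump m R0 x \<partial>lebesgue) = 0"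
      using zero Bochner_Integration.integral_nonneg_AE[OF nn] by linarith
    then have "AE x in lebesgue. H x * bump m R0 x = 0"
      using integral_nonneg_eq_0_iff_AE[OF Hi[OF R0] nn] by simp
    then show "AE x in lebesgue. x \<in> ball 0 R0 \<longrightarrow> w x \<le> 0"
    proof eventually_elim
      case (elim x)
      show ?case
      proof (intro impI, rule ccontr)
        assume x: "x \<in> ball 0 R0" and "\<not> w x \<le> 0"
        then have wx: "0 < w x" by simp
        then have "0 < c2 * w x powr q" using c by simp
        then have "0 < b x" using bw[OF wx] by linarith
        then have "0 < H x * bump m R0 x"
          using Tpos[OF wx] bump_pos[OF R0, of x m] x by (simp add: H_def)
        then show False using elim by simp
      qed
    qed
  qed
  \<comment> \<open>Countably many balls exhaust the space; \<open>Suc n\<close> keeps every radius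
    positive.\<close>
  then have "AE x in lebesgue. \<forall>n::nat. x \<in> ball 0 (real (Suc n)) \<longrightarrow> w x \<le> 0"
    by (subst AE_all_countable) auto
  then show ?thesis
  proof eventually_elim
    case (elim x)
    obtain n :: nat where "norm x < real n" using reals_Archimedean2 by blast
    then have "x \<in> ball 0 (real (Suc n))" by simp
    then show ?case using elim by blast
  qed
qed

section \<open>Comparison of weak solutions with each other and with constants\<close>

lemma C1_0_integrable:
  fixes \<phi> :: "'a::euclidean_space \<Rightarrow> real"
  assumes \<phi>: "\<phi> \<in> C1_0"
  shows "F \<in> Lloc 1 \<Longrightarrow> integrable lebesgue (\<lambda>x. inner (F x) (grad \<phi> x))"
    and "b \<in> Lloc 1 \<Longrightarrow> integrable lebesgue (\<lambda>x. b x * \<phi> x)"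
proof -
  let ?S = "closure (support_on UNIV \<phi>)"
  have S: "compact ?S" and cg: "continuous_on UNIV (grad \<phi>)" and "\<And>x. \<phi> differentiable (at x)"
    using \<phi> by (auto simp: C1_0_def)
  then have c: "continuous_on UNIV \<phi>"
    by (simp add: continuous_at_imp_continuous_on differentiable_imp_continuous_within)
  have z: "\<phi> x = 0" if "x \<notin> ?S" for x
    using that closure_subset[of "support_on UNIV \<phi>"] by (auto simp: support_on_def)
  \<comment> \<open>The complement of the closed support is open, so \<open>\<phi>\<close> vanishes
    near \<open>x\<close> and not merely at \<open>x\<close>.\<close>
  have gz: "grad \<phi> x = 0" if x: "x \<notin> ?S" for x
  proof (rule grad_eqI)
    have "((\<lambda>_. 0) has_derivative (\<lambda>h. 0)) (at x)" by simp
    then have "(\<phi> has_derivative (\<lambda>h. 0)) (at x)"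
      by (rule has_derivative_transform_within_open[where s = "- ?S"]) (use x z in auto)
    then show "GDERIV \<phi> x :> 0" by (simp add: gderiv_def)
  qed
  obtain B where B: "\<And>x. norm (grad \<phi> x) \<le> B"
    using bounded_compact_support[OF cg S] gz by blast
  obtain B' where B': "\<And>x. norm (\<phi> x) \<le> B'"
    using bounded_compact_support[OF c S] z by blast
  show "integrable lebesgue (\<lambda>x. inner (F x) (grad \<phi> x))" if "F \<in> Lloc 1"
    using gz by (intro integrable_inner_Lloc_1[OF that borel_measurable_lebesgue_continuous[OF cg] B S]) auto
  show "integrable lebesgue (\<lambda>x. b x * \<phi> x)" if "b \<in> Lloc 1"
    using integrable_scaleR_Lloc_1[OF that borel_measurable_lebesgue_continuous[OF c] _ S, of B'] B' z
    by (simp add: mult.commute)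
qed

abbreviation (input) signed_powr :: "real \<Rightarrow> real \<Rightarrow> real" where
  "signed_powr q t \<equiv> \<bar>t\<bar> powr (q - 1) * t"

lemma signed_powr_mono:
  assumes "1 < q" "s \<le> t"
  shows "signed_powr q s \<le> signed_powr q t"
proof (cases "s = t")
  case False
  have "0 \<le> 2 powr (- q) * (t - s) powr q" by simp
  then show ?thesis using diff_signed_powr_ge[of q s t] assms False by linarith
qed simp

text \<open>Supplies, for a real bound \<open>s\<close> of \<open>h\<close>, the constant that
  solves the equation with right hand side \<open>s\<close>.\<close>

lemma signed_powr_surj:
  assumes "1 < q"
  shows "\<exists>c. signed_powr q c = s"
proof (cases "s = 0")
  case False
  define c where "c = sgn s * \<bar>s\<bar> powr (1 / q)"
  have "\<bar>c\<bar> = \<bar>s\<bar> powr (1 / q)" using False by (simp add: c_def abs_mult abs_sgn_eq)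
  then have "signed_powr q c = sgn s * (\<bar>s\<bar> powr (1 / q * (q - 1)) * \<bar>s\<bar> powr (1 / q))"
    by (simp add: c_def powr_powr)
  also have "\<bar>s\<bar> powr (1 / q * (q - 1)) * \<bar>s\<bar> powr (1 / q) = \<bar>s\<bar> powr (1 / q * (q - 1) + 1 / q)"
    by (simp add: powr_add)
  also have "1 / q * (q - 1) + 1 / q = 1" using assms by (simp add: field_simps)
  finally show ?thesis by (intro exI[of _ c]) (simp add: sgn_mult_abs)
qed (auto intro: exI[of _ 0])

text \<open>The regularity shared by weak solutions and constants, without any equation, so that
  either kind can stand on either side of the comparison.\<close>

definition admissible :: "real \<Rightarrow> real \<Rightarrow> ('a::euclidean_space \<Rightarrow> real) \<Rightarrow> ('a \<Rightarrow> 'a) \<Rightarrow> bool" where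
  "admissible p q u G \<longleftrightarrow> mollified_gradient u G \<and> G \<in> Lloc p \<and>
     (\<lambda>x. flux p (G x)) \<in> Lloc (p / (p - 1)) \<and> (\<lambda>x. signed_powr q (u x)) \<in> Lloc 1"

lemma comparison_principle:
  fixes u v :: "'a::euclidean_space \<Rightarrow> real"
  assumes p: "1 < p" "p < 2" and q: "1 < q"
    and u: "admissible p q u G" and v: "admissible p q v H"
    and sub: "\<And>\<phi>. \<phi> \<in> C1_0 \<Longrightarrow> (\<And>x. 0 \<le> \<phi> x) \<Longrightarrow>
      (\<integral>x. inner (flux p (G x) - flux p (H x)) (grad \<phi> x) \<partial>lebesgue)
      + (\<integral>x. (signed_powr q (u x) - signed_powr q (v x)) * \<phi> x \<partial>lebesgue) \<le> 0"
  shows "AE x in lebesgue. u x \<le> v x"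
proof -
  have "AE x in lebesgue. u x - v x \<le> 0"
  proof (rule AE_nonpos_of_differential_inequality[OF p(1) _ _ _ _ _ sub])
    show "p - 1 < q" using p q by simp
    show "mollified_gradient (\<lambda>x. u x - v x) (\<lambda>x. G x - H x)"
      using u v by (intro mollified_gradient_diff) (auto simp: admissible_def)
    show "(\<lambda>x. G x - H x) \<in> Lloc p"
      using u v p by (intro Lloc_diff) (auto simp: admissible_def)
    show "(\<lambda>x. flux p (G x) - flux p (H x)) \<in> Lloc (p / (p - 1))"
      using u v p by (intro Lloc_diff) (auto simp: admissible_def)
    show "(\<lambda>x. signed_powr q (u x) - signed_powr q (v x)) \<in> Lloc 1"
      using u v by (intro Lloc_1_diff) (auto simp: admissible_def)
    show "0 < (2::real) powr (1 - p / (p - 1))" "0 < (2::real) powr (- q)" by auto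
    show "2 powr (1 - p / (p - 1)) * norm (flux p (G x) - flux p (H x)) powr (p / (p - 1))
        \<le> inner (flux p (G x) - flux p (H x)) (G x - H x)" for x
      by (rule norm_flux_diff_powr_le[OF p])
    show "2 powr (- q) * (u x - v x) powr q \<le> signed_powr q (u x) - signed_powr q (v x)"
      if "0 < u x - v x" for x
      using that by (intro diff_signed_powr_ge q) simp
  qed
  then show ?thesis by simp
qed

lemma admissible_const:
  "admissible p q (\<lambda>_::'a::euclidean_space. c) (\<lambda>_. 0)"
proof -
  have "(\<lambda>_::'a. 0::'a) \<in> Lloc s" for s by (simp add: Lloc_def set_integrable_def)
  then show ?thesis
    by (simp add: admissible_def mollified_gradient_const flux_def continuous_imp_Lloc_1)
qed

lemma weak_solution_admissible:
  fixes u :: "'a::euclidean_space \<Rightarrow> real"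
  assumes p: "1 < p" and q: "1 < q" and u: "weak_solution p q h u"
  obtains G where "admissible p q u G"
    "\<And>\<phi>. \<phi> \<in> C1_0 \<Longrightarrow> (\<integral>x. inner (flux p (G x)) (grad \<phi> x) \<partial>lebesgue)
      + (\<integral>x. signed_powr q (u x) * \<phi> x \<partial>lebesgue) = (\<integral>x. h x * \<phi> x \<partial>lebesgue)"
proof -
  obtain G where G: "weak_gradient u G" "(\<lambda>x. flux p (G x)) \<in> Lloc (p / (p - 1))"
    "\<And>\<phi>. \<phi> \<in> C1_0 \<Longrightarrow> (\<integral>x. inner (flux p (G x)) (grad \<phi> x) \<partial>lebesgue)
      + (\<integral>x. signed_powr q (u x) * \<phi> x \<partial>lebesgue) = (\<integral>x. h x * \<phi> x \<partial>lebesgue)"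
    using u unfolding weak_solution_def by blast
  have Gm: "G \<in> borel_measurable lebesgue" using G(1) by (simp add: weak_gradient_def Lloc_1_iff)
  \<comment> \<open>Integrability of this particular gradient is read off from its flux, so it need
    not be identified with the one that membership in \<open>W1loc\<close> provides.\<close>
  have "norm (flux p z) powr (p / (p - 1)) = norm z powr p" for z :: 'a
    using p by (simp add: norm_flux powr_powr)
  then have Gp: "G \<in> Lloc p" using G(2) Gm by (simp add: Lloc_def)
  have uq: "u \<in> Lloc q" using u by (simp add: weak_solution_def)
  then have [measurable]: "u \<in> borel_measurable lebesgue" by (simp add: Lloc_def)
  have "norm (signed_powr q t) = \<bar>t\<bar> powr q" for t
    using powr_mult_base[of "\<bar>t\<bar>" "q - 1"] by (simp add: abs_mult mult.commute)
  then have "(\<lambda>x. signed_powr q (u x)) \<in> Lloc 1"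
    using uq by (auto simp: Lloc_def)
  then show ?thesis
    using that[of G] G Gp weak_gradient_imp_mollified_gradient[OF G(1)] by (simp add: admissible_def)
qed

lemma weak_solution_unique:
  fixes u v :: "'a::euclidean_space \<Rightarrow> real"
  assumes p: "1 < p" "p < 2" and q: "1 < q"
    and u: "weak_solution p q h u" and v: "weak_solution p q h v"
  shows "AE x in lebesgue. u x = v x"
proof -
  have le: "AE x in lebesgue. u x \<le> v x"
    if u: "weak_solution p q h u" and v: "weak_solution p q h v" for u v :: "'a \<Rightarrow> real"
  proof -
    obtain G where G: "admissible p q u G"
      "\<And>\<phi>. \<phi> \<in> C1_0 \<Longrightarrow> (\<integral>x. inner (flux p (G x)) (grad \<phi> x) \<partial>lebesgue)
        + (\<integral>x. signed_powr q (u x) * \<phi> x \<partial>lebesgue) = (\<integral>x. h x * \<phi> x \<partial>lebesgue)"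
      using weak_solution_admissible[OF p(1) q u] by blast
    obtain H where H: "admissible p q v H"
      "\<And>\<phi>. \<phi> \<in> C1_0 \<Longrightarrow> (\<integral>x. inner (flux p (H x)) (grad \<phi> x) \<partial>lebesgue)
        + (\<integral>x. signed_powr q (v x) * \<phi> x \<partial>lebesgue) = (\<integral>x. h x * \<phi> x \<partial>lebesgue)"
      using weak_solution_admissible[OF p(1) q v] by blast
    have L: "(\<lambda>x. flux p (G x)) \<in> Lloc 1" "(\<lambda>x. flux p (H x)) \<in> Lloc 1"
      "(\<lambda>x. signed_powr q (u x)) \<in> Lloc 1" "(\<lambda>x. signed_powr q (v x)) \<in> Lloc 1"
      using G(1) H(1) p Lloc_mono_1[of "p / (p - 1)"] by (auto simp: admissible_def)
    show ?thesis
    proof (rule comparison_principle[OF p q G(1) H(1)])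
      fix \<phi> :: "'a \<Rightarrow> real" assume \<phi>: "\<phi> \<in> C1_0"
      show "(\<integral>x. inner (flux p (G x) - flux p (H x)) (grad \<phi> x) \<partial>lebesgue)
        + (\<integral>x. (signed_powr q (u x) - signed_powr q (v x)) * \<phi> x \<partial>lebesgue) \<le> 0"
        \<comment> \<open>The two equations have the same right hand side, so it cancels. The
          integrals are total functions, hence integrability of each term is required before their
          difference can be merged.\<close>
        using G(2)[OF \<phi>] H(2)[OF \<phi>] C1_0_integrable(1)[OF \<phi> L(1)] C1_0_integrable(1)[OF \<phi> L(2)]
          C1_0_integrable(2)[OF \<phi> L(3)] C1_0_integrable(2)[OF \<phi> L(4)]
        by (simp add: inner_diff_left left_diff_distrib)
    qed
  qed
  show ?thesis using le[OF u v] le[OF v u] by eventually_elim simp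
qed

text \<open>The constant \<open>c\<close> with \<open>signed_powr q c = s\<close> has zero flux and
  solves the equation with \<open>s\<close> in place of \<open>h\<close>. A one-sided bound on
  \<open>h\<close> therefore makes \<open>v\<close> a sub- or supersolution relative to
  \<open>c\<close>, as test functions are nonnegative.\<close>

lemma
  fixes v h :: "'a::euclidean_space \<Rightarrow> real"
  assumes p: "1 < p" "p < 2" and q: "1 < q" and h: "h \<in> Lloc 1" and v: "weak_solution p q h v"
  shows weak_solution_le: "AE x in lebesgue. h x \<le> s \<Longrightarrow> AE x in lebesgue. signed_powr q (v x) \<le> s"
    and weak_solution_ge: "AE x in lebesgue. s \<le> h x \<Longrightarrow> AE x in lebesgue. s \<le> signed_powr q (v x)"
proof -
  obtain G where G: "admissible p q v G"
    "\<And>\<phi>. \<phi> \<in> C1_0 \<Longrightarrow> (\<integral>x. inner (flux p (G x)) (grad \<phi> x) \<partial>lebesgue)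
      + (\<integral>x. signed_powr q (v x) * \<phi> x \<partial>lebesgue) = (\<integral>x. h x * \<phi> x \<partial>lebesgue)"
    using weak_solution_admissible[OF p(1) q v] by blast
  have L: "(\<lambda>x. flux p (G x)) \<in> Lloc 1" "(\<lambda>x. signed_powr q (v x)) \<in> Lloc 1"
    using G(1) p Lloc_mono_1[of "p / (p - 1)"] by (auto simp: admissible_def)
  obtain c where c: "signed_powr q c = s" using signed_powr_surj[OF q] by blast
  have "(\<lambda>_::'a. s) \<in> Lloc 1" by (intro continuous_imp_Lloc_1 continuous_intros)
  note i = C1_0_integrable(1)[OF _ L(1)] C1_0_integrable(2)[OF _ L(2)] C1_0_integrable(2)[OF _ h]
    C1_0_integrable(2)[OF _ this]
  show "AE x in lebesgue. signed_powr q (v x) \<le> s" if hs: "AE x in lebesgue. h x \<le> s"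
  proof -
    have "AE x in lebesgue. v x \<le> c"
    proof (rule comparison_principle[OF p q G(1) admissible_const])
      fix \<phi> :: "'a \<Rightarrow> real" assume \<phi>: "\<phi> \<in> C1_0" and nn: "\<And>x. 0 \<le> \<phi> x"
      have "(\<integral>x. h x * \<phi> x \<partial>lebesgue) \<le> (\<integral>x. s * \<phi> x \<partial>lebesgue)"
        using hs nn by (intro integral_mono_AE i \<phi>) (auto elim!: eventually_mono intro: mult_right_mono)
      then show "(\<integral>x. inner (flux p (G x) - flux p 0) (grad \<phi> x) \<partial>lebesgue)
        + (\<integral>x. (signed_powr q (v x) - signed_powr q c) * \<phi> x \<partial>lebesgue) \<le> 0"
        using G(2)[OF \<phi>] i(2,4)[OF \<phi>] unfolding c by (simp add: flux_def left_diff_distrib)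
    qed
    then show ?thesis by eventually_elim (use signed_powr_mono[OF q] c in metis)
  qed
  show "AE x in lebesgue. s \<le> signed_powr q (v x)" if hs: "AE x in lebesgue. s \<le> h x"
  proof -
    have "AE x in lebesgue. c \<le> v x"
    proof (rule comparison_principle[OF p q admissible_const G(1)])
      fix \<phi> :: "'a \<Rightarrow> real" assume \<phi>: "\<phi> \<in> C1_0" and nn: "\<And>x. 0 \<le> \<phi> x"
      have "(\<integral>x. s * \<phi> x \<partial>lebesgue) \<le> (\<integral>x. h x * \<phi> x \<partial>lebesgue)"
        using hs nn by (intro integral_mono_AE i \<phi>) (auto elim!: eventually_mono intro: mult_right_mono)
      then show "(\<integral>x. inner (flux p 0 - flux p (G x)) (grad \<phi> x) \<partial>lebesgue)
        + (\<integral>x. (signed_powr q c - signed_powr q (v x)) * \<phi> x \<partial>lebesgue) \<le> 0"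
        using G(2)[OF \<phi>] i(2,4)[OF \<phi>] unfolding c by (simp add: flux_def left_diff_distrib)
    qed
    then show ?thesis by eventually_elim (use signed_powr_mono[OF q] c in metis)
  qed
qed

section \<open>Bounds by the essential infimum and supremum\<close>

lemma essinf_AE:
  fixes f :: "'a \<Rightarrow> ereal"
  shows "AE x in M. essinf M f \<le> f x"
proof (cases "f \<in> borel_measurable M")
  case True
  \<comment> \<open>Reduction to the essential supremum by reflection; for a function that is not
    measurable the value is \<open>bot\<close>, and nothing is to prove.\<close>
  then have "essinf M f = - esssup M (\<lambda>x. - f x)"
    by (simp add: essinf_def esssup_def ereal_Limsup_uminus)
  with esssup_AE[of "\<lambda>x. - f x" M] show ?thesis
    by (auto elim!: eventually_mono simp: ereal_uminus_le_reorder)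
qed (simp add: essinf_def)

theorem theorem1p1:
  fixes p q :: real and h :: "real ^ 'n \<Rightarrow> real"
  assumes "1 < p" and "p < 2" and "1 < q" and "h \<in> Lloc 1"
  shows "(\<forall>u v. weak_solution p q h u \<and> weak_solution p q h v \<longrightarrow>
            (AE x in lebesgue. u x = v x)) \<and>
         (\<forall>v. weak_solution p q h v \<longrightarrow>
            (AE x in lebesgue.
               essinf lebesgue (\<lambda>y. ereal (h y)) \<le> ereal (\<bar>v x\<bar> powr (q - 1) * v x) \<and>
               ereal (\<bar>v x\<bar> powr (q - 1) * v x) \<le> esssup lebesgue (\<lambda>y. ereal (h y))))"
proof (intro conjI allI impI)
  fix u v assume "weak_solution p q h u \<and> weak_solution p q h v"
  then show "AE x in lebesgue. u x = v x"
    using weak_solution_unique assms by blast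
next
  fix v assume v: "weak_solution p q h v"
  \<comment> \<open>Lebesgue measure is not the zero measure. This excludes an essential supremum of
    minus infinity and an essential infimum of plus infinity, since \<open>h\<close> takes only real
    values.\<close>
  have ne: "\<not> (AE x in (lebesgue :: (real ^ 'n) measure). False)"
    by (simp add: AE_iff_measurable[OF _ refl])
  have "AE x in lebesgue. ereal (signed_powr q (v x)) \<le> esssup lebesgue (\<lambda>y. ereal (h y))"
  proof (cases "esssup lebesgue (\<lambda>y. ereal (h y))")
    case (real s)
    have "AE x in lebesgue. h x \<le> s"
      using esssup_AE[of "\<lambda>y. ereal (h y)" lebesgue] real by simp
    from weak_solution_le[OF assms v this] show ?thesis using real by simp
  next
    case MInf
    then show ?thesis using esssup_AE[of "\<lambda>y. ereal (h y)" lebesgue] ne by simp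
  qed simp
  moreover have "AE x in lebesgue. essinf lebesgue (\<lambda>y. ereal (h y)) \<le> ereal (signed_powr q (v x))"
  proof (cases "essinf lebesgue (\<lambda>y. ereal (h y))")
    case (real s)
    have "AE x in lebesgue. s \<le> h x"
      using essinf_AE[of lebesgue "\<lambda>y. ereal (h y)"] real by simp
    from weak_solution_ge[OF assms v this] show ?thesis using real by simp
  next
    case PInf
    then show ?thesis using essinf_AE[of lebesgue "\<lambda>y. ereal (h y)"] ne by simp
  qed simp
  ultimately show "AE x in lebesgue.
      essinf lebesgue (\<lambda>y. ereal (h y)) \<le> ereal (signed_powr q (v x)) \<and>
      ereal (signed_powr q (v x)) \<le> esssup lebesgue (\<lambda>y. ereal (h y))"
    by eventually_elim simp
qed

end
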